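(* There exist $d\in\mathbb{N}$, $\varepsilon>0$ and a family $\{X_r : r\in\mathbb{R}\}$ of $(d,\varepsilon)$-expanders such that for all $r,s\in\mathbb{R}$ with $r\neq s$ there is no regular map $X_r\to X_s$.
   Context: Graphs are simple and undirected; $|\Gamma|$ is the number of vertices of $\Gamma$. For a finite graph $\Gamma$ with $n\ge 2$ vertices and $A\subseteq V(\Gamma)$, the vertex boundary $\partial A$ is the set of vertices of $V(\Gamma)\setminus A$ having a neighbour in $A$, and the (vertex) Cheeger constant is $h(\Gamma)=\min\{|\partial A|/|A| : \emptyset\neq A\subseteq V(\Gamma),\ |A|\le n/2\}$. An $\varepsilon$-expander is an infinite (disjoint) union $X=\bigsqcup_{n\in\mathbb{N}}\Gamma_n$ of distinct (pairwise non-isomorphic) finite graphs $\Gamma_n$, each with at least two vertices, with $h(\Gamma_n)\ge\varepsilon>0$ for all $n$. It is a $(d,\varepsilon)$-expander if moreover every vertex has degree at most $d$. Each component carries the shortest path metric, and vertices in different components are at infinite distance. A map $\phi:VX\to VX'$ between the vertex sets of two graphs is regular if it is Lipschitz (there is $K$ such that $d(\phi(x),\phi(y))\le K\,d(x,y)$ for all $x,y$ in the same component of $X$) and pre-images of vertices have uniformly bounded cardinality. "A regular map $X\to X'$" means a regular map $VX\to VX'$. *)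

theory Defs
  imports
    "Graph_Theory.Digraph_Isomorphism"
    "Graph_Theory.Pair_Digraph"
    "Graph_Theory.Shortest_Path"
begin

text \<open>
  A simple undirected graph is a symmetric loop-free digraph without parallel arcs, each edge
  being represented by its two orientations; \<^locale>\<open>pair_graph\<close> is the finite case. The infinite
  graphs below are of type \<^type>\<open>pair_pre_digraph\<close> as well, as disjoint unions of such graphs.
\<close>

definition vertex_boundary :: "'a pair_pre_digraph \<Rightarrow> 'a set \<Rightarrow> 'a set" where
  "vertex_boundary G A = {v \<in> pverts G - A. \<exists>u\<in>A. (u, v) \<in> parcs G}"

text \<open>The minimum is over a nonempty set only if \<open>G\<close> has at least two vertices.\<close>

definition cheeger_constant :: "'a pair_pre_digraph \<Rightarrow> real" where
  "cheeger_constant G =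
     Min {real (card (vertex_boundary G A)) / real (card A) | A.
            A \<noteq> {} \<and> A \<subseteq> pverts G \<and> real (card A) \<le> real (card (pverts G)) / 2}"

definition is_disjoint_union :: "'a pair_pre_digraph \<Rightarrow> ('i \<Rightarrow> 'a pair_pre_digraph) \<Rightarrow> bool" where
  "is_disjoint_union X \<Gamma> \<longleftrightarrow>
     disjoint_family (\<lambda>i. pverts (\<Gamma> i)) \<and>
     X = \<lparr>pverts = (\<Union>i. pverts (\<Gamma> i)), parcs = (\<Union>i. parcs (\<Gamma> i))\<rparr>"

definition expander :: "real \<Rightarrow> 'a pair_pre_digraph \<Rightarrow> bool" where
  "expander \<epsilon> X \<longleftrightarrow> \<epsilon> > 0 \<and>
     (\<exists>\<Gamma> :: nat \<Rightarrow> 'a pair_pre_digraph.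
        is_disjoint_union X \<Gamma> \<and>
        (\<forall>n. pair_graph (\<Gamma> n) \<and> card (pverts (\<Gamma> n)) \<ge> 2 \<and> cheeger_constant (\<Gamma> n) \<ge> \<epsilon>) \<and>
        (\<forall>m n. m \<noteq> n \<longrightarrow> \<not> digraph_iso (with_proj (\<Gamma> m)) (with_proj (\<Gamma> n))))"

text \<open>As arcs come in both orientations, the degree of a vertex is its out-degree.\<close>

definition bounded_degree_expander :: "nat \<Rightarrow> real \<Rightarrow> 'a pair_pre_digraph \<Rightarrow> bool" where
  "bounded_degree_expander d \<epsilon> X \<longleftrightarrow>
     expander \<epsilon> X \<and> (\<forall>v\<in>pverts X. out_degree (with_proj X) v \<le> d)"

definition graph_dist :: "'a pair_pre_digraph \<Rightarrow> 'a \<Rightarrow> 'a \<Rightarrow> ereal" where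
  "graph_dist G = wf_digraph.\<mu> (with_proj G) (\<lambda>_. 1)"

text \<open>
  The distance is infinite between different components, so the Lipschitz condition includes that
  \<open>\<phi>\<close> maps components into components. Only the values of \<open>\<phi>\<close> on \<open>pverts X\<close> matter.
\<close>

definition regular_graph_map ::
  "'a pair_pre_digraph \<Rightarrow> 'b pair_pre_digraph \<Rightarrow> ('a \<Rightarrow> 'b) \<Rightarrow> bool" where
  "regular_graph_map X Y \<phi> \<longleftrightarrow>
     \<phi> ` pverts X \<subseteq> pverts Y \<and>
     (\<exists>K :: real. \<forall>x\<in>pverts X. \<forall>y\<in>pverts X. reachable (with_proj X) x y \<longrightarrow>
        graph_dist Y (\<phi> x) (\<phi> y) \<le> ereal K * graph_dist X x y) \<and>
     (\<exists>N :: nat. \<forall>z\<in>pverts Y. finite {x \<in> pverts X. \<phi> x = z} \<and> card {x \<in> pverts X. \<phi> x = z} \<le> N)"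

end

theory Submission
  imports Defs
begin

text \<open>
  Let \<open>\<Gamma> 0, \<Gamma> 1, \<dots>\<close> be expanders of bounded degree in which the sizes \<open>k i = |\<Gamma> i|\<close> grow so fast that
  \<open>k (i + 1) > k i\<^sup>2\<close>, and such that vertex sets of \<open>\<Gamma> (i + 1)\<close> of size at most \<open>k i\<^sup>2\<close> span forests.
  For \<open>i\<close> large in terms of the constants, there is no regular map \<open>\<Gamma> i \<rightarrow> \<Gamma> j\<close> with \<open>j \<noteq> i\<close>: if \<open>j < i\<close>,
  then some fibre is too large; if \<open>j > i\<close>, then a neighbourhood of the image spans a forest, and a
  one-vertex separator of this forest pulls back to a large subset of \<open>\<Gamma> i\<close> with bounded boundary.
  So \<open>X r\<close> can be taken as the union of the \<open>\<Gamma> i\<close> with \<open>i \<in> M r\<close>, where the infinite sets \<open>M r\<close> of indices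
  have pairwise finite intersections.

  The expanders come from a random graph with \<open>n\<close> vertices and \<open>C n\<close> edges. With positive probability,
  any two sets of at least \<open>n / 16\<close> vertices are joined by an edge (union bound), and few
  sets \<open>S\<close> of bounded size span \<open>|S|\<close> or more edges (Markov's inequality). Deleting the vertices
  of high degree and one vertex of each such \<open>S\<close>, and then a largest non-expanding set, leaves a
  bounded-degree expander that is locally a forest.
\<close>

section \<open>Random graphs\<close>

text \<open>Probability is replaced by counting functions on \<open>{..<M}\<close>: divided by the
  number \<open>card T ^ M\<close> of all functions, this is the independence of the events
  \<open>f i \<in> P\<close> for \<open>i \<in> I\<close>.\<close>

lemma card_PiE_image_subset:
  assumes "finite T" "P \<subseteq> T" "I \<subseteq> {..<M}"
  shows "card {f \<in> {..<M::nat} \<rightarrow>\<^sub>E T. f ` I \<subseteq> P} = card P ^ card I * card T ^ (M - card I)"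
proof -
  have "{f \<in> {..<M} \<rightarrow>\<^sub>E T. f ` I \<subseteq> P} = (\<Pi>\<^sub>E i\<in>{..<M}. if i \<in> I then P else T)"
  proof (intro equalityI subsetI)
    fix f assume "f \<in> (\<Pi>\<^sub>E i\<in>{..<M}. if i \<in> I then P else T)"
    then have f: "f \<in> extensional {..<M}" "\<And>i. i < M \<Longrightarrow> f i \<in> (if i \<in> I then P else T)"
      by (auto simp: PiE_iff)
    have "f i \<in> P" if "i \<in> I" for i using f(2)[of i] that assms(3) by auto
    moreover have "f i \<in> T" if "i < M" for i using f(2)[of i] that assms(2) by (auto split: if_splits)
    ultimately show "f \<in> {f \<in> {..<M} \<rightarrow>\<^sub>E T. f ` I \<subseteq> P}" using f(1) by (auto simp: PiE_iff)
  qed (auto simp: PiE_iff)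
  also have "card \<dots> = (\<Prod>i<M. if i \<in> I then card P else card T)"
    by (subst card_PiE) (auto intro: prod.cong)
  also have "\<dots> = card P ^ card I * card T ^ card ({..<M} - I)"
    using assms(3) by (simp add: prod.If_cases Int_absorb1 Diff_eq)
  also have "card ({..<M} - I) = M - card I"
    using assms(3) by (simp add: card_Diff_subset finite_subset)
  finally show ?thesis .
qed

lemma card_PiE_avoiding:
  assumes "finite T" "P \<subseteq> T"
  shows "card {f \<in> {..<M::nat} \<rightarrow>\<^sub>E T. \<forall>i<M. f i \<notin> P} = (card T - card P) ^ M"
proof -
  have "{f \<in> {..<M} \<rightarrow>\<^sub>E T. \<forall>i<M. f i \<notin> P} = {..<M} \<rightarrow>\<^sub>E (T - P)"
    using assms by (auto simp: PiE_iff extensional_def)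
  then show ?thesis
    using assms by (simp add: card_PiE card_Diff_subset finite_subset)
qed

text \<open>A sequence \<open>f\<close> of \<open>M\<close> pairs is read as a multigraph with possible loops; \<open>I\<close> witnesses that \<open>S\<close>
  spans at least \<open>|S|\<close> of its edges.\<close>

definition dense_spots :: "nat \<Rightarrow> 'a set \<Rightarrow> nat \<Rightarrow> (nat \<Rightarrow> 'a \<times> 'a) \<Rightarrow> ('a set \<times> nat set) set" where
  "dense_spots g U M f =
     {(S, I). S \<subseteq> U \<and> S \<noteq> {} \<and> card S \<le> g \<and> I \<subseteq> {..<M} \<and> card I = card S \<and> f ` I \<subseteq> S \<times> S}"

text \<open>Union bound. There are at most 4^n pairs (A, B). A random pair of vertices misses A x B
  with probability at most 255/256 = 1 - 1/16^2, so all \<open>C*n\<close> of them do so with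
  probability at most 16^(-n) by the choice of \<open>C\<close>. The total is at most
  4^(-n).\<close>

lemma card_not_joined:
  fixes U :: "'a set"
  assumes "finite U" "card U = n" "n > 0" and C: "(255/256) ^ C \<le> (1/16::real)"
  shows "real (card {f \<in> {..<C*n} \<rightarrow>\<^sub>E U \<times> U. \<exists>A B. A \<subseteq> U \<and> B \<subseteq> U \<and> n \<le> 16 * card A \<and>
            n \<le> 16 * card B \<and> (\<forall>i<C*n. f i \<notin> A \<times> B)}) \<le> (n * n) ^ (C * n) / 4"
    (is "real (card ?Bad) \<le> _")
proof -
  define Q where "Q = {(A, B). A \<subseteq> U \<and> B \<subseteq> U \<and> n \<le> 16 * card A \<and> n \<le> 16 * card B}"
  define F where "F = (\<lambda>(A, B). {f \<in> {..<C*n} \<rightarrow>\<^sub>E U \<times> U. \<forall>i<C*n. f i \<notin> A \<times> B})"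
  have Q: "Q \<subseteq> Pow U \<times> Pow U" by (auto simp: Q_def)
  then have finQ: "finite Q" using assms(1) by (meson finite_Pow_iff finite_SigmaI finite_subset)
  have "card Q \<le> card (Pow U \<times> Pow U)"
    using Q assms(1) by (intro card_mono) auto
  then have cQ: "real (card Q) \<le> 4 ^ n"
    using assms(1,2) by (simp add: card_cartesian_product card_Pow flip: power_mult_distrib of_nat_le_iff)
  have F: "real (card (F q)) \<le> (n * n) ^ (C * n) * (1/16) ^ n" if "q \<in> Q" for q
  proof -
    obtain A B where q: "q = (A, B)" by (cases q)
    with that have AB: "A \<subseteq> U" "B \<subseteq> U" "n \<le> 16 * card A" "n \<le> 16 * card B"
      by (auto simp: Q_def)
    have "card (F q) = (card (U \<times> U) - card (A \<times> B)) ^ (C * n)"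
      using card_PiE_avoiding[of "U \<times> U" "A \<times> B" "C * n"] assms(1) AB
      by (simp add: F_def q Sigma_mono)
    then have "real (card (F q)) = real (n * n - card A * card B) ^ (C * n)"
      using assms(2) by (simp add: card_cartesian_product)
    also have "real (n * n - card A * card B) \<le> 255/256 * (n * n)"
    proof -
      have "n * n \<le> (16 * card A) * (16 * card B)" using AB by (intro mult_le_mono)
      then have "256 * (n * n - card A * card B) \<le> 255 * (n * n)" by simp
      then show ?thesis by (simp flip: of_nat_mult of_nat_le_iff)
    qed
    then have "real (n * n - card A * card B) ^ (C * n) \<le> (255/256 * (n * n)) ^ (C * n)"
      by (intro power_mono) auto
    also have "\<dots> = (n * n) ^ (C * n) * ((255/256) ^ C) ^ n"
      by (subst power_mult_distrib) (simp add: power_mult mult.commute del: power_divide of_nat_mult)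
    also have "\<dots> \<le> (n * n) ^ (C * n) * (1/16) ^ n"
      using C by (intro mult_left_mono power_mono) auto
    finally show ?thesis .
  qed
  have "finite ({..<C*n} \<rightarrow>\<^sub>E U \<times> U)" using assms(1) by (intro finite_PiE) auto
  then have finF: "finite (F q)" for q
    unfolding F_def by (cases q) (simp add: finite_subset)
  have "?Bad \<subseteq> (\<Union>q\<in>Q. F q)" by (auto simp: Q_def F_def)
  then have "card ?Bad \<le> card (\<Union>q\<in>Q. F q)"
    by (intro card_mono finite_UN_I finQ finF)
  also have "\<dots> \<le> (\<Sum>q\<in>Q. card (F q))" by (intro card_UN_le finQ)
  finally have "real (card ?Bad) \<le> (\<Sum>q\<in>Q. real (card (F q)))"
    by (simp flip: of_nat_sum)
  also have "\<dots> \<le> (\<Sum>q\<in>Q. (n * n) ^ (C * n) * (1/16) ^ n)" by (intro sum_mono F)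
  also have "\<dots> = real (card Q) * ((n * n) ^ (C * n) * (1/16) ^ n)" by simp
  also have "\<dots> \<le> 4 ^ n * ((n * n) ^ (C * n) * (1/16) ^ n)"
    by (intro mult_right_mono cQ) auto
  also have "\<dots> = (n * n) ^ (C * n) * (4 * (1/16)) ^ n"
    by (simp only: power_mult_distrib) (simp add: mult_ac)
  also have "\<dots> \<le> (n * n) ^ (C * n) * (1/4) ^ 1"
  proof (rule mult_left_mono)
    show "(4 * (1/16)) ^ n \<le> (1/4 :: real) ^ 1"
      using power_decreasing[of 1 n "1/4 :: real"] assms(3) by simp
  qed simp
  finally show ?thesis by simp
qed

lemma card_filter:
  "finite A \<Longrightarrow> card {x \<in> A. P x} = (\<Sum>x\<in>A. if P x then 1 else 0)"
  by (simp add: sum.If_cases Int_def)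

text \<open>First moment. For |S| = |I| = s there are at most n^s (Cn)^s choices, each with
  probability (s^2/n^2)^s, and all powers of n cancel. So the mean number of dense spots has a bound
  that does not depend on n.\<close>

lemma sum_card_dense_spots:
  fixes U :: "'a set"
  assumes "finite U" "card U = n" "C > 0" "n > 0"
  shows "(\<Sum>f\<in>{..<C*n} \<rightarrow>\<^sub>E U \<times> U. card (dense_spots g U (C*n) f))
           \<le> g * (C * g * g) ^ g * (n * n) ^ (C * n)"
proof -
  define \<Omega> where "\<Omega> = {..<C*n} \<rightarrow>\<^sub>E U \<times> U"
  define M where "M = C * n"
  define Q where "Q s = {S. S \<subseteq> U \<and> card S = s} \<times> {I. I \<subseteq> {..<M} \<and> card I = s}" for s
  have fin\<Omega>: "finite \<Omega>" using assms(1) by (auto simp: \<Omega>_def intro: finite_PiE)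
  have finQ: "finite (Q s)" for s
    using assms(1) by (auto simp: Q_def)
  have ds: "dense_spots g U M f = (\<Union>s\<in>{1..g}. {q \<in> Q s. f ` snd q \<subseteq> fst q \<times> fst q})" for f
  proof (intro set_eqI)
    fix q :: "'a set \<times> nat set"
    obtain S I where q: "q = (S, I)" by (cases q)
    define P where "P \<longleftrightarrow> f ` I \<subseteq> S \<times> S"
    have "S \<subseteq> U \<Longrightarrow> S \<noteq> {} \<longleftrightarrow> 1 \<le> card S"
      using assms(1) by (auto simp: Suc_le_eq card_gt_0_iff finite_subset)
    then show "q \<in> dense_spots g U M f \<longleftrightarrow> q \<in> (\<Union>s\<in>{1..g}. {q \<in> Q s. f ` snd q \<subseteq> fst q \<times> fst q})"
      unfolding dense_spots_def Q_def q mem_Collect_eq case_prod_conv UN_iff mem_Times_iff fst_conv snd_conv P_def[symmetric]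
      by auto
  qed
  have per: "(\<Sum>f\<in>\<Omega>. card {q \<in> Q s. f ` snd q \<subseteq> fst q \<times> fst q}) \<le> (C * g * g) ^ g * (n * n) ^ M"
    if s: "s \<in> {1..g}" for s
  proof -
    have "(\<Sum>f\<in>\<Omega>. card {q \<in> Q s. f ` snd q \<subseteq> fst q \<times> fst q})
        = (\<Sum>f\<in>\<Omega>. \<Sum>q\<in>Q s. if f ` snd q \<subseteq> fst q \<times> fst q then 1 else 0)"
      by (intro sum.cong refl) (simp add: card_filter finQ)
    also have "\<dots> = (\<Sum>q\<in>Q s. card {f \<in> \<Omega>. f ` snd q \<subseteq> fst q \<times> fst q})"
      by (subst sum.swap) (simp add: card_filter fin\<Omega>)
    also have "\<dots> \<le> (\<Sum>q\<in>Q s. (s * s) ^ s * (n * n) ^ (M - s))"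
    proof (intro sum_mono)
      fix q assume "q \<in> Q s"
      then obtain S I where q: "q = (S, I)" "S \<subseteq> U" "card S = s" "I \<subseteq> {..<M}" "card I = s"
        by (auto simp: Q_def)
      show "card {f \<in> \<Omega>. f ` snd q \<subseteq> fst q \<times> fst q} \<le> (s * s) ^ s * (n * n) ^ (M - s)"
        using card_PiE_image_subset[of "U \<times> U" "S \<times> S" I M] q assms(1,2)
        by (simp add: \<Omega>_def M_def card_cartesian_product Sigma_mono)
    qed
    also have "\<dots> = (n choose s) * (M choose s) * ((s * s) ^ s * (n * n) ^ (M - s))"
      using n_subsets[OF assms(1)] n_subsets[of "{..<M}"] assms(2)
      by (simp add: Q_def card_cartesian_product)
    also have "\<dots> \<le> (C * g * g) ^ g * (n * n) ^ M"
    \<comment> \<open>If s > n, no \<open>S\<close> exists and the binomial coefficient vanishes.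
      Otherwise s \<le> M, so that the subtraction \<open>M - s\<close> on naturals is
      exact.\<close>
    proof (cases "s \<le> n")
      case True
      moreover have "1 * n \<le> C * n" using assms(3) by (intro mult_le_mono1) simp
      ultimately have "s \<le> M" unfolding M_def by linarith
      have "(n choose s) * (M choose s) * ((s * s) ^ s * (n * n) ^ (M - s))
          \<le> n ^ s * M ^ s * ((s * s) ^ s * (n * n) ^ (M - s))"
        using True \<open>s \<le> M\<close> by (intro mult_le_mono binomial_le_pow) auto
      also have "\<dots> = (C * s * s) ^ s * ((n * n) ^ s * (n * n) ^ (M - s))"
        by (simp add: M_def power_mult_distrib mult_ac)
      also have "(n * n) ^ s * (n * n) ^ (M - s) = (n * n) ^ M"
        using \<open>s \<le> M\<close> by (simp flip: power_add)
      also have "(C * s * s) ^ s \<le> (C * g * g) ^ g"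
      proof -
        have "(C * s * s) ^ s \<le> (C * g * g) ^ s" using s by (intro power_mono mult_le_mono) auto
        also have "\<dots> \<le> (C * g * g) ^ g" using s assms(3) by (intro power_increasing) auto
        finally show ?thesis .
      qed
      finally show ?thesis by simp
    qed (simp add: binomial_eq_0)
    finally show ?thesis .
  qed
  have "(\<Sum>f\<in>\<Omega>. card (dense_spots g U M f))
      \<le> (\<Sum>f\<in>\<Omega>. \<Sum>s\<in>{1..g}. card {q \<in> Q s. f ` snd q \<subseteq> fst q \<times> fst q})"
    unfolding ds by (intro sum_mono card_UN_le) auto
  also have "\<dots> \<le> (\<Sum>s\<in>{1..g}. (C * g * g) ^ g * (n * n) ^ M)"
    by (subst sum.swap) (intro sum_mono per)
  finally show ?thesis by (simp add: \<Omega>_def M_def mult_ac)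
qed

text \<open>At most a quarter of the N sequences violate the joining property, so at least half
  remain. If each of these had at least n/32 dense spots, the total would be at least N n / 64,
  against the first moment bound; hence the constant 64 in the lower bound for n.\<close>

lemma exists_edge_sequence:
  assumes C: "(255/256) ^ C \<le> (1/16::real)"
    and U: "finite U" "card U = n" and n: "64 * (g * (C * g * g) ^ g) < n"
  shows "\<exists>f \<in> {..<C*n} \<rightarrow> U \<times> U.
           (\<forall>A B. A \<subseteq> U \<and> B \<subseteq> U \<and> n \<le> 16 * card A \<and> n \<le> 16 * card B \<longrightarrow> (\<exists>i<C*n. f i \<in> A \<times> B)) \<and>
           32 * card (dense_spots g U (C*n) f) \<le> n"
proof (rule ccontr)
  assume neg: "\<not> ?thesis"
  have "C > 0" using C by (cases C) auto
  define \<Omega> where "\<Omega> = {..<C*n} \<rightarrow>\<^sub>E U \<times> U"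
  define Bad where "Bad = {f \<in> \<Omega>. \<exists>A B. A \<subseteq> U \<and> B \<subseteq> U \<and> n \<le> 16 * card A \<and>
            n \<le> 16 * card B \<and> (\<forall>i<C*n. f i \<notin> A \<times> B)}"
  define N where "N = (n * n) ^ (C * n)"
  have fin: "finite \<Omega>" using U(1) by (auto simp: \<Omega>_def intro: finite_PiE)
  have card: "card \<Omega> = N"
    using U by (simp add: \<Omega>_def N_def card_PiE card_cartesian_product)
  have "N > 0" using n by (simp add: N_def)
  have bad: "real (card Bad) \<le> N / 4"
    using card_not_joined[OF U _ C] n unfolding Bad_def \<Omega>_def N_def by auto
  have good: "card (\<Omega> - Bad) = N - card Bad"
    using fin by (subst card_Diff_subset) (auto simp: Bad_def card intro: finite_subset)
  have "n \<le> 32 * card (dense_spots g U (C*n) f)" if "f \<in> \<Omega> - Bad" for f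
  proof (rule ccontr)
    assume "\<not> ?thesis"
    then have "32 * card (dense_spots g U (C*n) f) \<le> n" by simp
    moreover have "f \<in> {..<C*n} \<rightarrow> U \<times> U" using that by (auto simp: \<Omega>_def)
    moreover have "\<forall>A B. A \<subseteq> U \<and> B \<subseteq> U \<and> n \<le> 16 * card A \<and> n \<le> 16 * card B \<longrightarrow> (\<exists>i<C*n. f i \<in> A \<times> B)"
      using that by (auto simp: Bad_def)
    ultimately show False using neg by blast
  qed
  then have "(\<Sum>f\<in>\<Omega> - Bad. n) \<le> (\<Sum>f\<in>\<Omega> - Bad. 32 * card (dense_spots g U (C*n) f))"
    by (rule sum_mono)
  also have "\<dots> \<le> (\<Sum>f\<in>\<Omega>. 32 * card (dense_spots g U (C*n) f))"
    using fin by (intro sum_mono2) auto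
  also have "\<dots> = 32 * (\<Sum>f\<in>\<Omega>. card (dense_spots g U (C*n) f))" by (simp add: sum_distrib_left)
  also have "\<dots> \<le> 32 * (g * (C * g * g) ^ g * N)"
    using sum_card_dense_spots[OF U \<open>C > 0\<close>, of g] n unfolding N_def \<Omega>_def by (intro mult_le_mono2) auto
  finally have "2 * ((N - card Bad) * n) \<le> 64 * (g * (C * g * g) ^ g) * N" by (simp add: good mult_ac)
  moreover have "N \<le> 2 * (N - card Bad)"
  proof -
    have "4 * card Bad \<le> N" using bad by linarith
    then show ?thesis by simp
  qed
  then have "N * n \<le> 2 * ((N - card Bad) * n)" by (metis mult.assoc mult_le_mono1)
  moreover have "64 * (g * (C * g * g) ^ g) * N < N * n" using n \<open>N > 0\<close> by (metis mult.commute mult_less_mono1)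
  ultimately show False by linarith
qed

section \<open>Sparse expanders, by deletion from a random multigraph\<close>

text \<open>Phrased by leaves rather than cycles: applied to all subsets of a set of at most
  \<open>g\<close> vertices, it says that this set spans a forest. This form passes to induced
  subgraphs and lets leaves be removed one by one.\<close>

definition locally_forest :: "nat \<Rightarrow> 'a pair_pre_digraph \<Rightarrow> bool" where
  "locally_forest g G \<longleftrightarrow>
     (\<forall>S \<subseteq> pverts G. S \<noteq> {} \<and> card S \<le> g \<longrightarrow> (\<exists>v\<in>S. card {u \<in> S. (v, u) \<in> parcs G} \<le> 1))"

text \<open>The last clause is h(G) \<ge> 1/2 without division. The parameter \<open>g\<close> is
  the scale of the forests and also a lower bound for the number of vertices, so that larger
  \<open>g\<close> forces larger graphs.\<close>

definition sparse_expander :: "nat \<Rightarrow> nat \<Rightarrow> 'a pair_pre_digraph \<Rightarrow> bool" where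
  "sparse_expander d g G \<longleftrightarrow>
     pair_graph G \<and> g \<le> card (pverts G) \<and> locally_forest g G \<and>
     (\<forall>v. card {u. (v, u) \<in> parcs G} \<le> d) \<and>
     (\<forall>A \<subseteq> pverts G. A \<noteq> {} \<and> 2 * card A \<le> card (pverts G) \<longrightarrow> card A \<le> 2 * card (vertex_boundary G A))"

lemma pair_graphI:
  assumes "finite (pverts G)" "parcs G \<subseteq> pverts G \<times> pverts G" "sym (parcs G)" "irrefl (parcs G)"
  shows "pair_graph G"
proof unfold_locales
  show "finite (parcs G)" using assms by (meson finite_SigmaI finite_subset)
  show "symmetric (with_proj G)" using assms(3) by (simp add: symmetric_def)
qed (use assms in \<open>auto simp: irrefl_def\<close>)

text \<open>Each of the two deletions costs at most n/32 vertices. The joining property survives, as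
  it concerns all large subsets of \<open>U\<close>. \<open>A\<close> and \<open>B\<close> are
  disjoint because the pair that joins them could otherwise be a loop, and loops are
  discarded.\<close>

lemma exists_joined_locally_forest:
  assumes C: "(255/256) ^ C \<le> (1/16::real)"
    and U: "finite U" "card U = n" and n: "64 * (g * (C * g * g) ^ g) < n"
  obtains G where "pair_graph G" "pverts G \<subseteq> U" "15 * n \<le> 16 * card (pverts G)" "locally_forest g G"
    "\<And>v. card {u. (v, u) \<in> parcs G} \<le> 64 * C"
    "\<And>A B. A \<subseteq> pverts G \<Longrightarrow> B \<subseteq> pverts G \<Longrightarrow> A \<inter> B = {} \<Longrightarrow> n \<le> 16 * card A \<Longrightarrow> n \<le> 16 * card B \<Longrightarrow>
        \<exists>a\<in>A. \<exists>b\<in>B. (a, b) \<in> parcs G"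
proof -
  have "C > 0" using C by (cases C) auto
  define M where "M = C * n"
  obtain f where f: "f \<in> {..<M} \<rightarrow> U \<times> U"
    and joined: "\<forall>A B. A \<subseteq> U \<and> B \<subseteq> U \<and> n \<le> 16 * card A \<and> n \<le> 16 * card B \<longrightarrow> (\<exists>i<M. f i \<in> A \<times> B)"
    and dense: "32 * card (dense_spots g U M f) \<le> n"
    using exists_edge_sequence[OF assms] unfolding M_def by blast
  define inc where "inc v = {i \<in> {..<M}. fst (f i) = v \<or> snd (f i) = v}" for v
  have fin_inc: "finite (inc v)" for v by (simp add: inc_def)
  \<comment> \<open>The \<open>C*n\<close> pairs have at most 2Cn ends in total, so at most n/32
    vertices lie in more than 64C of them.\<close>
  define D1 where "D1 = {v \<in> U. 64 * C < card (inc v)}"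
  define D2 where "D2 = (\<lambda>(S, I). SOME v. v \<in> S) ` dense_spots g U M f"
  define V where "V = U - (D1 \<union> D2)"
  define E where "E = {(u, v). u \<in> V \<and> v \<in> V \<and> u \<noteq> v \<and> (\<exists>i<M. f i = (u, v) \<or> f i = (v, u))}"
  define G where "G = \<lparr>pverts = V, parcs = E\<rparr>"
  have VU: "V \<subseteq> U" by (auto simp: V_def)
  have finV: "finite V" using VU U(1) finite_subset by blast
  have graph: "pair_graph G"
    by (rule pair_graphI) (auto simp: G_def E_def finV sym_def irrefl_def)

  have finds: "finite (dense_spots g U M f)"
    by (rule finite_subset[of _ "Pow U \<times> Pow {..<M}"]) (use U(1) in \<open>auto simp: dense_spots_def\<close>)
  have "card D2 \<le> card (dense_spots g U M f)" unfolding D2_def by (rule card_image_le[OF finds])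
  then have D2: "32 * card D2 \<le> n" using dense by linarith
  have "card D1 * (64 * C) \<le> (\<Sum>v\<in>D1. card (inc v))"
    by (rule sum_bounded_below[where K = "64 * C", simplified]) (auto simp: D1_def)
  also have "\<dots> \<le> (\<Sum>v\<in>U. card (inc v))" using U(1) by (intro sum_mono2) (auto simp: D1_def)
  also have "\<dots> = (\<Sum>v\<in>U. \<Sum>i<M. if fst (f i) = v \<or> snd (f i) = v then 1 else 0)"
    unfolding inc_def by (intro sum.cong refl card_filter) simp
  also have "\<dots> \<le> (\<Sum>i<M. \<Sum>v\<in>U. (if v = fst (f i) then 1 else 0) + (if v = snd (f i) then 1 else 0))"
    by (subst sum.swap) (auto intro!: sum_mono)
  also have "\<dots> \<le> (\<Sum>i<M. 2)" using U(1) by (intro sum_mono) (simp add: sum.distrib)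
  finally have "C * (32 * card D1) \<le> C * n" by (simp add: M_def mult_ac)
  then have D1: "32 * card D1 \<le> n" using \<open>C > 0\<close> by simp
  have "card U - card (D1 \<union> D2) \<le> card V" unfolding V_def by (rule diff_card_le_card_Diff)
      (use U(1) finds in \<open>auto simp: D1_def D2_def\<close>)
  then have cardV: "15 * n \<le> 16 * card V" using D1 D2 U(2) card_Un_le[of D1 D2] by linarith

  have deg: "card {u. (v, u) \<in> E} \<le> 64 * C" for v
  proof (cases "v \<in> V")
    case True
    have "{u. (v, u) \<in> E} \<subseteq> (\<lambda>i. if fst (f i) = v then snd (f i) else fst (f i)) ` inc v"
    proof
      fix u assume "u \<in> {u. (v, u) \<in> E}"
      then obtain i where "i < M" "f i = (v, u) \<or> f i = (u, v)" by (auto simp: E_def)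
      then show "u \<in> (\<lambda>i. if fst (f i) = v then snd (f i) else fst (f i)) ` inc v"
        by (intro rev_image_eqI[of i]; cases "f i") (auto simp: inc_def)
    qed
    then have "card {u. (v, u) \<in> E} \<le> card (inc v)" by (rule surj_card_le[OF fin_inc])
    also have "\<dots> \<le> 64 * C" using True by (auto simp: V_def D1_def)
    finally show ?thesis .
  qed (simp add: E_def)

  have forest: "locally_forest g G"
    unfolding locally_forest_def
  proof (intro allI impI)
    fix S assume S: "S \<subseteq> pverts G" "S \<noteq> {} \<and> card S \<le> g"
    have finS: "finite S" using S(1) finV finite_subset by (auto simp: G_def)
    show "\<exists>v\<in>S. card {u \<in> S. (v, u) \<in> parcs G} \<le> 1"
    proof (rule ccontr)
      assume "\<not> ?thesis"
      then have two: "\<And>v. v \<in> S \<Longrightarrow> 2 \<le> card {u \<in> S. (v, u) \<in> E}" by (auto simp: G_def)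
      \<comment> \<open>All degrees inside \<open>S\<close> being at least 2, \<open>S\<close>
        contains at least 2|S| arcs. Each index in \<open>J\<close> accounts for at most two of
        them, one per orientation, so |S| of the indices make \<open>S\<close> a dense spot, of
        which a vertex was deleted.\<close>
      define J where "J = {i \<in> {..<M}. f i \<in> S \<times> S}"
      have finJ: "finite J" by (simp add: J_def)
      have "2 * card S \<le> (\<Sum>v\<in>S. card {u \<in> S. (v, u) \<in> E})"
        using sum_bounded_below[of S 2 "\<lambda>v. card {u \<in> S. (v, u) \<in> E}"] two by (simp add: mult.commute)
      also have "\<dots> = card (SIGMA v:S. {u \<in> S. (v, u) \<in> E})" using finS by simp
      also have "\<dots> \<le> card (f ` J \<union> prod.swap ` f ` J)"
      proof (rule card_mono)
        show "(SIGMA v:S. {u \<in> S. (v, u) \<in> E}) \<subseteq> f ` J \<union> prod.swap ` f ` J"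
        proof clarify
          fix v u assume "v \<in> S" "u \<in> S" "(v, u) \<in> E" "(v, u) \<notin> prod.swap ` f ` J"
          then show "(v, u) \<in> f ` J" unfolding E_def J_def by (force simp: image_iff)
        qed
      qed (simp add: finJ)
      also have "\<dots> \<le> card (f ` J) + card (prod.swap ` f ` J)" by (rule card_Un_le)
      also have "\<dots> \<le> card J + card J"
        by (intro add_mono card_image_le finJ order_trans[OF card_image_le]) (simp_all add: finJ)
      finally have "card S \<le> card J" by simp
      then obtain I where I: "I \<subseteq> J" "card I = card S" by (metis obtain_subset_with_card_n)
      have "(S, I) \<in> dense_spots g U M f"
        using S I VU by (auto simp: dense_spots_def J_def G_def)
      then have "(SOME v. v \<in> S) \<in> D2" unfolding D2_def by (rule rev_image_eqI) simp
      moreover have "(SOME v. v \<in> S) \<in> S" using S(2) by (simp add: some_in_eq)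
      ultimately show False using S(1) by (auto simp: G_def V_def)
    qed
  qed

  have "\<exists>a\<in>A. \<exists>b\<in>B. (a, b) \<in> E"
    if AB: "A \<subseteq> V" "B \<subseteq> V" "A \<inter> B = {}" "n \<le> 16 * card A" "n \<le> 16 * card B" for A B
  proof -
    have "A \<subseteq> U" "B \<subseteq> U" using AB VU by simp_all
    then have "\<exists>i<M. f i \<in> A \<times> B" using joined AB(4,5) by simp
    then obtain i where i: "i < M" "f i \<in> A \<times> B" by (elim exE conjE) (rule that)
    obtain a b where ab: "f i = (a, b)" by (cases "f i")
    then have "a \<in> A" "b \<in> B" using i(2) by auto
    moreover from this have "(a, b) \<in> E" using AB i(1) ab by (auto simp: E_def)
    ultimately show ?thesis by blast
  qed
  with graph VU cardV deg forest show ?thesis by (intro that[of G]) (auto simp: G_def)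
qed

section \<open>Expanding induced subgraphs\<close>

definition induced :: "'a pair_pre_digraph \<Rightarrow> 'a set \<Rightarrow> 'a pair_pre_digraph" where
  "induced G W = \<lparr>pverts = W, parcs = parcs G \<inter> W \<times> W\<rparr>"

lemma pair_graph_induced:
  assumes "pair_graph G" "W \<subseteq> pverts G"
  shows "pair_graph (induced G W)"
proof -
  interpret pair_graph G by fact
  have "finite W" using assms(2) by (rule finite_subset) simp
  then show ?thesis
    by (intro pair_graphI) (auto simp: induced_def sym_def irrefl_def arcs_symmetric dest: no_loops')
qed

lemma locally_forest_induced:
  assumes "locally_forest g G" "W \<subseteq> pverts G"
  shows "locally_forest g (induced G W)"
  unfolding locally_forest_def
proof (intro allI impI)
  fix S assume S: "S \<subseteq> pverts (induced G W)" "S \<noteq> {} \<and> card S \<le> g"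
  then have "S \<subseteq> W" by (simp add: induced_def)
  then obtain v where "v \<in> S" "card {u \<in> S. (v, u) \<in> parcs G} \<le> 1"
    using assms S(2) unfolding locally_forest_def by (meson order_trans)
  moreover have "{u \<in> S. (v, u) \<in> parcs (induced G W)} = {u \<in> S. (v, u) \<in> parcs G}"
    using \<open>v \<in> S\<close> \<open>S \<subseteq> W\<close> by (auto simp: induced_def)
  ultimately show "\<exists>v\<in>S. card {u \<in> S. (v, u) \<in> parcs (induced G W)} \<le> 1"
    by (intro bexI[of _ v]) simp_all
qed

text \<open>Removing a largest non-expanding set of at most \<open>n / 8\<close> vertices leaves an expander:
  a non-expanding set of the remainder either is small, and could have been removed as well, or is
  large, and is then joined to a large set.\<close>

lemma exists_expanding_induced:
  assumes G: "pair_graph G" and big: "15 * n \<le> 16 * card (pverts G)"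
    and joined: "\<And>A B. A \<subseteq> pverts G \<Longrightarrow> B \<subseteq> pverts G \<Longrightarrow> A \<inter> B = {} \<Longrightarrow> n \<le> 16 * card A \<Longrightarrow>
        n \<le> 16 * card B \<Longrightarrow> \<exists>a\<in>A. \<exists>b\<in>B. (a, b) \<in> parcs G"
  obtains W where "W \<subseteq> pverts G" "14 * n \<le> 16 * card W"
    "\<And>A. A \<subseteq> W \<Longrightarrow> A \<noteq> {} \<Longrightarrow> 2 * card A \<le> card W \<Longrightarrow> card A \<le> 2 * card (vertex_boundary (induced G W) A)"
proof -
  interpret pair_graph G by fact
  define V where "V = pverts G"
  have finV: "finite V" by (simp add: V_def)
  have fin: "finite A" if "A \<subseteq> V" for A using that finV finite_subset by blast
  have bdV: "vertex_boundary G A \<subseteq> V" for A by (auto simp: vertex_boundary_def V_def)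
  define small where "small Z \<longleftrightarrow> Z \<subseteq> V \<and> 8 * card Z \<le> n \<and> 2 * card (vertex_boundary G Z) \<le> card Z" for Z
  have "small {}" by (simp add: small_def vertex_boundary_def)
  then obtain Z where Z: "small Z" and Zmax: "\<And>Y. small Y \<Longrightarrow> card Y \<le> card Z"
    using ex_has_greatest_nat[of small "{}" card "Suc n"] by (auto simp: small_def)
  have rest: "card (V - A - vertex_boundary G A) \<ge> card V - card A - card (vertex_boundary G A)"
    if "A \<subseteq> V" for A
  proof -
    have "card (V - A) - card (vertex_boundary G A) \<le> card (V - A - vertex_boundary G A)"
      by (rule diff_card_le_card_Diff) (rule fin[OF bdV])
    then show ?thesis using that fin[OF that] by (simp add: card_Diff_subset)
  qed
  \<comment> \<open>Otherwise there would be an edge between \<open>Z\<close> and the vertices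
    outside \<open>Z\<close> and its boundary, of which there are at least (15 - 2 - 1) n /
    16.\<close>
  have Zsmall: "16 * card Z < n"
  proof (rule ccontr)
    assume "\<not> ?thesis"
    moreover have "n \<le> 16 * card (V - Z - vertex_boundary G Z)"
      using rest[of Z] Z big unfolding small_def V_def by linarith
    ultimately have "\<exists>a\<in>Z. \<exists>b\<in>V - Z - vertex_boundary G Z. (a, b) \<in> parcs G"
      using Z by (intro joined) (auto simp: small_def V_def)
    then show False by (auto simp: vertex_boundary_def V_def)
  qed
  define W where "W = V - Z"
  have cardW: "card W = card V - card Z"
    using Z unfolding W_def by (intro card_Diff_subset) (auto simp: small_def fin)
  have W14: "14 * n \<le> 16 * card W" using cardW Zsmall big unfolding V_def by linarith
  show ?thesis
  proof (rule that[of W])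
    fix A assume A: "A \<subseteq> W" "A \<noteq> {}" "2 * card A \<le> card W"
    let ?B = "vertex_boundary (induced G W) A"
    have BW: "?B \<subseteq> W" by (auto simp: vertex_boundary_def induced_def)
    show "card A \<le> 2 * card ?B"
    proof (rule ccontr)
      assume neg: "\<not> ?thesis"
      have AV: "A \<subseteq> V" and WV: "W \<subseteq> V" using A by (auto simp: W_def)
      \<comment> \<open>This makes \<open>Z \<union> A\<close> non-expanding again. By the
        maximality of \<open>Z\<close> it has more than n/8 vertices, and more than n/16 of them lie
        in \<open>A\<close>.\<close>
      have "vertex_boundary G (Z \<union> A) \<subseteq> vertex_boundary G Z \<union> ?B"
        using A(1) by (auto simp: vertex_boundary_def induced_def W_def V_def)
      then have "card (vertex_boundary G (Z \<union> A)) \<le> card (vertex_boundary G Z \<union> ?B)"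
        using bdV BW WV by (intro card_mono fin) auto
      then have 1: "card (vertex_boundary G (Z \<union> A)) \<le> card (vertex_boundary G Z) + card ?B"
        using card_Un_le order_trans by blast
      have 2: "card (Z \<union> A) = card Z + card A"
        using Z A AV by (intro card_Un_disjoint) (auto simp: small_def fin W_def)
      have "card A > 0" using A(2) fin[OF AV] by (simp add: card_gt_0_iff)
      have "\<not> small (Z \<union> A)" using Zmax[of "Z \<union> A"] 2 \<open>card A > 0\<close> by auto
      then have "n < 8 * card (Z \<union> A)"
        using Z AV neg 1 2 unfolding small_def by auto
      then have A16: "n \<le> 16 * card A" using 2 Zsmall by linarith
      \<comment> \<open>As |A| \<le> |W|/2 and |?B| < |A|/2, at least |W|/4 vertices remain, which
        is at least n/16. An edge from \<open>A\<close> to one of them would put it into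
        \<open>?B\<close>.\<close>
      have "card (W - A) - card ?B \<le> card (W - A - ?B)"
        using BW WV by (intro diff_card_le_card_Diff fin) auto
      moreover have "card (W - A) = card W - card A" using A fin[OF AV] by (simp add: card_Diff_subset)
      ultimately have "n \<le> 16 * card (W - A - ?B)" using A(3) neg W14 by linarith
      then have "\<exists>a\<in>A. \<exists>b\<in>W - A - ?B. (a, b) \<in> parcs G"
        using A16 AV WV by (intro joined) (auto simp: V_def)
      then show False using A(1) by (auto simp: vertex_boundary_def induced_def)
    qed
  qed (use W14 in \<open>auto simp: W_def V_def\<close>)
qed

text \<open>The density \<open>C\<close>, and with it the degree bound 64C, is fixed before
  \<open>g\<close>; only \<open>n\<close> depends on \<open>g\<close>. The vertex set
  \<open>U\<close> is left arbitrary so that the graphs can later be placed on disjoint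
  sets.\<close>

lemma exists_sparse_expander:
  "\<exists>d. \<forall>g. \<exists>n. \<forall>U :: 'a set. finite U \<and> card U = n \<longrightarrow> (\<exists>G. pverts G \<subseteq> U \<and> sparse_expander d g G)"
proof -
  obtain C where C: "(255/256) ^ C < (1/16::real)" using real_arch_pow_inv[of "1/16" "255/256"] by auto
  show ?thesis
  proof (rule exI[of _ "64 * C"], rule allI)
    fix g
    \<comment> \<open>The first summand serves the first moment bound, which is strict; 2g makes the
      remaining 14n/16 vertices at least \<open>g\<close> in number.\<close>
    define n where "n = 64 * (g * (C * g * g) ^ g) + 2 * g + 1"
    have "\<exists>G. pverts G \<subseteq> U \<and> sparse_expander (64 * C) g G" if U: "finite U" "card U = n" for U :: "'a set"
    proof -
      have n: "64 * (g * (C * g * g) ^ g) < n" by (simp add: n_def)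
      obtain G where G: "pair_graph G" "pverts G \<subseteq> U" "15 * n \<le> 16 * card (pverts G)" "locally_forest g G"
        and deg: "\<And>v. card {u. (v, u) \<in> parcs G} \<le> 64 * C"
        and joined: "\<And>A B. A \<subseteq> pverts G \<Longrightarrow> B \<subseteq> pverts G \<Longrightarrow> A \<inter> B = {} \<Longrightarrow> n \<le> 16 * card A \<Longrightarrow> n \<le> 16 * card B \<Longrightarrow>
          \<exists>a\<in>A. \<exists>b\<in>B. (a, b) \<in> parcs G"
        by (rule exists_joined_locally_forest[OF less_imp_le[OF C] U n]) (rule that; blast)
      obtain W where W: "W \<subseteq> pverts G" "14 * n \<le> 16 * card W"
        and exp: "\<And>A. A \<subseteq> W \<Longrightarrow> A \<noteq> {} \<Longrightarrow> 2 * card A \<le> card W \<Longrightarrow> card A \<le> 2 * card (vertex_boundary (induced G W) A)"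
        using exists_expanding_induced[OF G(1,3) joined] by blast
      interpret pair_graph G by fact
      have "card {u. (v, u) \<in> parcs (induced G W)} \<le> 64 * C" for v
      proof -
        have "finite {u. (v, u) \<in> parcs G}"
          by (rule finite_subset[of _ "pverts G"]) (auto dest: in_arcsD2)
        then have "card {u. (v, u) \<in> parcs (induced G W)} \<le> card {u. (v, u) \<in> parcs G}"
          by (intro card_mono) (auto simp: induced_def)
        then show ?thesis using deg order_trans by blast
      qed
      moreover have "g \<le> card W" using W(2) by (simp add: n_def)
      ultimately have "sparse_expander (64 * C) g (induced G W)"
        using pair_graph_induced[OF G(1) W(1)] locally_forest_induced[OF G(4) W(1)] exp
        by (simp add: sparse_expander_def induced_def)
      moreover have "pverts (induced G W) \<subseteq> U" using W(1) G(2) by (auto simp: induced_def)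
      ultimately show ?thesis by blast
    qed
    then show "\<exists>n. \<forall>U :: 'a set. finite U \<and> card U = n \<longrightarrow> (\<exists>G. pverts G \<subseteq> U \<and> sparse_expander (64 * C) g G)"
      by blast
  qed
qed

section \<open>Separators of forests\<close>

text \<open>Leaves are removed one after another, and the rank is the time of removal. When a vertex
  is removed, at most one of its neighbours is still present, so at most one has a larger
  rank.\<close>

lemma forest_elimination_order:
  assumes "finite S" "\<And>T. T \<subseteq> S \<Longrightarrow> T \<noteq> {} \<Longrightarrow> \<exists>v\<in>T. card {u \<in> T. (v, u) \<in> E} \<le> 1"
  shows "\<exists>rank :: 'a \<Rightarrow> nat. inj_on rank S \<and>
    (\<forall>v\<in>S. \<forall>x\<in>S. \<forall>y\<in>S. (v, x) \<in> E \<and> (v, y) \<in> E \<and> rank v < rank x \<and> rank v < rank y \<longrightarrow> x = y)"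
  using assms
proof (induction "card S" arbitrary: S)
  case 0
  then show ?case by auto
next
  case (Suc n)
  then have "S \<noteq> {}" by auto
  then obtain v where v: "v \<in> S" "card {u \<in> S. (v, u) \<in> E} \<le> 1" using Suc.prems(2)[of S] by auto
  have "n = card (S - {v})" using Suc.hyps(2) v(1) Suc.prems(1) by simp
  moreover have "\<exists>v\<in>T. card {u \<in> T. (v, u) \<in> E} \<le> 1" if "T \<subseteq> S - {v}" "T \<noteq> {}" for T
    using Suc.prems(2)[of T] that by blast
  ultimately obtain rank :: "'a \<Rightarrow> nat" where inj: "inj_on rank (S - {v})"
    and uniq: "\<forall>u\<in>S-{v}. \<forall>x\<in>S-{v}. \<forall>y\<in>S-{v}.
      (u, x) \<in> E \<and> (u, y) \<in> E \<and> rank u < rank x \<and> rank u < rank y \<longrightarrow> x = y"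
    using Suc.hyps(1)[of "S - {v}"] Suc.prems(1) by auto
  define rank' where "rank' x = (if x = v then 0 else Suc (rank x))" for x
  have inj': "inj_on rank' S" using inj by (auto simp: inj_on_def rank'_def)
  have uniq': "x = y" if "u \<in> S" "x \<in> S" "y \<in> S" "(u, x) \<in> E" "(u, y) \<in> E" "rank' u < rank' x" "rank' u < rank' y" for u x y
  proof (cases "u = v")
    case True
    then show ?thesis using v(2) that Suc.prems(1) by (auto simp: card_le_Suc0_iff_eq)
  next
    case False
    then have "x \<noteq> v" "y \<noteq> v" using that by (auto simp: rank'_def)
    then show ?thesis using uniq[rule_format, of u x y] that False by (simp add: rank'_def)
  qed
  show ?case
    by (intro exI[of _ rank'] conjI inj' ballI impI; elim conjE) (rule uniq')
qed

lemma sum_UN_le_nat: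
  fixes w :: "'a \<Rightarrow> nat"
  assumes "finite C" "\<And>c. c \<in> C \<Longrightarrow> finite (F c)"
  shows "sum w (\<Union>c\<in>C. F c) \<le> (\<Sum>c\<in>C. sum w (F c))"
  using assms
proof (induction C)
  case (insert c C)
  have "sum w (F c \<union> (\<Union>c\<in>C. F c)) + sum w (F c \<inter> (\<Union>c\<in>C. F c)) = sum w (F c) + sum w (\<Union>c\<in>C. F c)"
    using insert by (intro sum.union_inter) auto
  then show ?case using insert by auto
qed simp

text \<open>In an elimination order every vertex has at most one later neighbour, its parent. The set \<open>D\<close>
  consists of the descendants of some \<open>v\<close>, so all edges that leave it start at \<open>v\<close>.\<close>

lemma forest_separator:
  fixes w :: "'a \<Rightarrow> nat"
  assumes fin: "finite S" and forest: "\<And>T. T \<subseteq> S \<Longrightarrow> T \<noteq> {} \<Longrightarrow> \<exists>v\<in>T. card {u \<in> T. (v, u) \<in> E} \<le> 1"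
    and "sym E" and deg: "\<And>v. v \<in> S \<Longrightarrow> card {u \<in> S. (v, u) \<in> E} \<le> d"
    and w: "\<And>v. v \<in> S \<Longrightarrow> w v \<le> N" and x: "x \<in> S" "0 < w x"
  obtains D v where "D \<subseteq> S" "0 < sum w D" "sum w D \<le> N + (d + 1) * t"
    "\<And>u y. u \<in> D \<Longrightarrow> y \<in> S - D \<Longrightarrow> (u, y) \<in> E \<Longrightarrow> u = v \<and> t < sum w D"
proof -
  obtain rank :: "'a \<Rightarrow> nat" where inj: "inj_on rank S"
    and uniq: "\<And>v x y. v \<in> S \<Longrightarrow> x \<in> S \<Longrightarrow> y \<in> S \<Longrightarrow> (v, x) \<in> E \<Longrightarrow> (v, y) \<in> E \<Longrightarrow> rank v < rank x \<Longrightarrow> rank v < rank y \<Longrightarrow> x = y"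
    using forest_elimination_order[OF fin forest] by metis
  define R where "R = {(u, x). u \<in> S \<and> x \<in> S \<and> (u, x) \<in> E \<and> rank u < rank x}"
  define D where "D v = {u. (u, v) \<in> R\<^sup>*}" for v
  have DS: "D v \<subseteq> S" if "v \<in> S" for v
  proof
    fix u assume "u \<in> D v"
    then have "(u, v) \<in> R\<^sup>*" by (simp add: D_def)
    then show "u \<in> S" using that by (induction rule: converse_rtrancl_induct) (auto simp: R_def)
  qed
  have finD: "finite (D v)" if "v \<in> S" for v using DS[OF that] fin finite_subset by blast
  \<comment> \<open>An edge from \<open>D v\<close> to a lower rank stays in \<open>D v\<close>. An
    edge to a higher rank leads to the parent, which is unique and for \<open>u \<noteq> v\<close>
    is the next vertex on the path from \<open>u\<close> to \<open>v\<close>, again in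
    \<open>D v\<close>.\<close>
  have leave: "u = v \<and> (v, y) \<in> R" if "v \<in> S" "u \<in> D v" "y \<in> S - D v" "(u, y) \<in> E" for u v y
  proof -
    have uS: "u \<in> S" and yS: "y \<in> S" using that DS by auto
    have "u \<noteq> y" using that by auto
    then have "rank u \<noteq> rank y" using inj uS yS by (auto simp: inj_on_def)
    moreover have "\<not> rank y < rank u"
    proof
      assume "rank y < rank u"
      then have "(y, u) \<in> R" using that uS yS \<open>sym E\<close> by (auto simp: R_def sym_def)
      then show False using that by (auto simp: D_def intro: converse_rtrancl_into_rtrancl)
    qed
    ultimately have uy: "(u, y) \<in> R" using that uS yS by (auto simp: R_def)
    have "u = v"
    proof (rule ccontr)
      assume "u \<noteq> v"
      moreover have "(u, v) \<in> R\<^sup>*" using that by (simp add: D_def)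
      ultimately obtain z where "(u, z) \<in> R" "(z, v) \<in> R\<^sup>*" by (meson converse_rtranclE)
      moreover from this have "z = y" using uy uniq by (auto simp: R_def)
      ultimately show False using that by (simp add: D_def)
    qed
    with uy show ?thesis by simp
  qed
  show ?thesis
  proof (cases "\<exists>v\<in>S. t < sum w (D v)")
    case True
    \<comment> \<open>A heavy vertex of least rank: its children have smaller rank, so their
      descendant sets weigh at most \<open>t\<close> each, which bounds the weight of
      \<open>D v\<close> by N + d t.\<close>
    then obtain v where v: "v \<in> S" "t < sum w (D v)"
      and vmin: "\<And>u. u \<in> S \<Longrightarrow> t < sum w (D u) \<Longrightarrow> rank v \<le> rank u"
      using ex_has_least_nat[of "\<lambda>v. v \<in> S \<and> t < sum w (D v)" _ rank] by blast
    define Ch where "Ch = {c. (c, v) \<in> R}"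
    have Ch: "Ch \<subseteq> {u \<in> S. (v, u) \<in> E}" using \<open>sym E\<close> by (auto simp: Ch_def R_def sym_def)
    then have "card Ch \<le> card {u \<in> S. (v, u) \<in> E}" using fin by (intro card_mono) auto
    then have cCh: "card Ch \<le> d" using deg[OF v(1)] by simp
    have finCh: "finite Ch" using Ch fin by (auto intro: finite_subset)
    have "D v \<subseteq> {v} \<union> (\<Union>c\<in>Ch. D c)"
      by (auto simp: D_def Ch_def elim: rtranclE)
    then have "sum w (D v) \<le> sum w ({v} \<union> (\<Union>c\<in>Ch. D c))"
      using finCh Ch by (intro sum_mono2) (auto intro: finD)
    also have "\<dots> \<le> w v + sum w (\<Union>c\<in>Ch. D c)"
      using finCh Ch by (auto simp: sum.insert_if finD subset_iff)
    also have "sum w (\<Union>c\<in>Ch. D c) \<le> (\<Sum>c\<in>Ch. sum w (D c))"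
      using finCh Ch by (intro sum_UN_le_nat finD) auto
    also have "\<dots> \<le> (\<Sum>c\<in>Ch. t)"
    proof (rule sum_mono)
      fix c assume "c \<in> Ch"
      then have "c \<in> S" "rank c < rank v" by (auto simp: Ch_def R_def)
      then show "sum w (D c) \<le> t" using vmin[of c] by (meson not_le)
    qed
    also have "\<dots> \<le> d * t" using cCh by simp
    finally have "sum w (D v) \<le> N + (d + 1) * t" using w[OF v(1)] by simp
    then show ?thesis
    proof (rule that[of "D v" v, rotated 2])
      show "D v \<subseteq> S" "0 < sum w (D v)" using DS v by auto
      show "u = v \<and> t < sum w (D v)" if "u \<in> D v" "y \<in> S - D v" "(u, y) \<in> E" for u y
        using leave[OF v(1) that] v(2) by simp
    qed
  next
    case False
    \<comment> \<open>No descendant set is heavy. Following parents from \<open>x\<close> ends at a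
      root \<open>r\<close>. No edge leaves \<open>D r\<close>, so the exit condition holds
      vacuously, and \<open>x \<in> D r\<close> makes the weight positive.\<close>
    define Y where "Y = {y. (x, y) \<in> R\<^sup>*}"
    have YS: "Y \<subseteq> S"
    proof
      fix y assume "y \<in> Y"
      then have "(x, y) \<in> R\<^sup>*" by (simp add: Y_def)
      then show "y \<in> S" using x(1) by (induction rule: rtrancl_induct) (auto simp: R_def)
    qed
    have "x \<in> Y" by (simp add: Y_def)
    moreover have "finite Y" using YS fin finite_subset by blast
    ultimately have "Max (rank ` Y) \<in> rank ` Y" by (intro Max_in) auto
    then obtain r where r: "r \<in> Y" "rank r = Max (rank ` Y)" by (metis imageE)
    then have rmax: "rank y \<le> rank r" if "y \<in> Y" for y using \<open>finite Y\<close> that by simp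
    have noR: "(r, y) \<notin> R" for y
    proof
      assume "(r, y) \<in> R"
      then have "y \<in> Y" "rank r < rank y" using r(1) by (auto simp: Y_def R_def intro: rtrancl_into_rtrancl)
      then show False using rmax[of y] by simp
    qed
    have "r \<in> S" using r(1) YS by auto
    have "x \<in> D r" using r(1) by (simp add: D_def Y_def)
    then have "w x \<le> sum w (D r)" using finD[OF \<open>r \<in> S\<close>] by (intro member_le_sum) auto
    moreover have "sum w (D r) \<le> t" using False \<open>r \<in> S\<close> by (auto simp: not_less)
    ultimately show ?thesis using leave[OF \<open>r \<in> S\<close>] noR DS[OF \<open>r \<in> S\<close>] x(2)
      by (intro that[of "D r" r]) simp_all
  qed
qed

section \<open>Balls, and regular maps into local forests\<close>

definition relball :: "'a rel \<Rightarrow> nat \<Rightarrow> 'a \<Rightarrow> 'a set" where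
  "relball E k p = {x. \<exists>j\<le>k. (p, x) \<in> E ^^ j}"

lemma card_relball:
  assumes "finite E" and deg: "\<And>v. card {u. (v, u) \<in> E} \<le> d"
  shows "finite (relball E k p) \<and> card (relball E k p) \<le> (d + 1) ^ k"
proof (induction k)
  case 0
  have "relball E 0 p = {p}" by (auto simp: relball_def)
  then show ?case by simp
next
  case (Suc k)
  let ?B = "relball E k p"
  have fin: "finite {u. (v, u) \<in> E}" for v
    by (rule finite_subset[OF _ finite_imageI[OF assms(1), of snd]]) force
  have sub: "relball E (Suc k) p \<subseteq> ?B \<union> (\<Union>v\<in>?B. {u. (v, u) \<in> E})"
  proof
    fix x assume "x \<in> relball E (Suc k) p"
    then obtain j where j: "j \<le> Suc k" "(p, x) \<in> E ^^ j" by (auto simp: relball_def)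
    show "x \<in> ?B \<union> (\<Union>v\<in>?B. {u. (v, u) \<in> E})"
    proof (cases "j \<le> k")
      case True
      then show ?thesis using j(2) by (auto simp: relball_def)
    next
      case False
      then have "j = Suc k" using j(1) by simp
      then obtain v where "(p, v) \<in> E ^^ k" "(v, x) \<in> E" using j(2) by auto
      then show ?thesis by (auto simp: relball_def)
    qed
  qed
  have fU: "finite (?B \<union> (\<Union>v\<in>?B. {u. (v, u) \<in> E}))" using Suc.IH fin by auto
  have "card (relball E (Suc k) p) \<le> card (?B \<union> (\<Union>v\<in>?B. {u. (v, u) \<in> E}))"
    by (rule card_mono[OF fU sub])
  also have "\<dots> \<le> card ?B + card (\<Union>v\<in>?B. {u. (v, u) \<in> E})" by (rule card_Un_le)
  also have "card (\<Union>v\<in>?B. {u. (v, u) \<in> E}) \<le> (\<Sum>v\<in>?B. card {u. (v, u) \<in> E})"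
    using Suc.IH by (intro card_UN_le) auto
  also have "\<dots> \<le> (\<Sum>v\<in>?B. d)" by (intro sum_mono deg)
  also have "card ?B + (\<Sum>v\<in>?B. d) = card ?B * (d + 1)" by simp
  also have "\<dots> \<le> (d + 1) ^ k * (d + 1)" using Suc.IH by (intro mult_le_mono1) simp
  finally show ?case using finite_subset[OF sub fU] by (simp add: mult.commute)
qed

text \<open>The walk is cut at its first step out of \<open>D\<close>. The first i + 1 steps show
  that \<open>y\<close> is near \<open>a\<close>, the last j - i that \<open>b\<close> is near
  \<open>u\<close>; the exit step is counted in both.\<close>

lemma relpow_exit:
  assumes "(a, b) \<in> E ^^ j" "a \<in> D" "b \<notin> D"
  shows "\<exists>i u y. i < j \<and> (a, y) \<in> E ^^ Suc i \<and> u \<in> D \<and> y \<notin> D \<and> (u, y) \<in> E \<and> (u, b) \<in> E ^^ (j - i)"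
  using assms
proof (induction j arbitrary: a)
  case 0
  then show ?case by auto
next
  case (Suc j)
  obtain c where c: "(a, c) \<in> E" "(c, b) \<in> E ^^ j" using relpow_Suc_D2[OF Suc.prems(1)] by blast
  show ?case
  proof (cases "c \<in> D")
    case True
    then obtain i u y where *: "i < j" "(c, y) \<in> E ^^ Suc i" "u \<in> D" "y \<notin> D" "(u, y) \<in> E" "(u, b) \<in> E ^^ (j - i)"
      using Suc.IH[OF c(2) True Suc.prems(3)] by blast
    have "(a, y) \<in> E ^^ Suc (Suc i)" using relpow_Suc_I2[OF c(1) *(2)] .
    then show ?thesis using * by (intro exI[of _ "Suc i"] exI[of _ u] exI[of _ y]) simp
  next
    case False
    then show ?thesis using c Suc.prems
      by (intro exI[of _ 0] exI[of _ a] exI[of _ c]) simp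
  qed
qed

lemma relpow_closed:
  assumes "(a, b) \<in> E ^^ j" "a \<in> V" "\<And>x y. x \<in> V \<Longrightarrow> (x, y) \<in> E \<Longrightarrow> y \<in> V"
  shows "b \<in> V"
  using assms by (induction j arbitrary: b) auto

lemma sum_card_fibres:
  assumes "finite V" "finite D"
  shows "(\<Sum>z\<in>D. card {x \<in> V. \<phi> x = z}) = card {x \<in> V. \<phi> x \<in> D}"
proof -
  have "{x \<in> V. \<phi> x \<in> D} = (\<Union>z\<in>D. {x \<in> V. \<phi> x = z})" by auto
  then show ?thesis using assms by (simp, subst card_UN_disjoint) auto
qed

text \<open>The balls around the image points form a forest. A separator of this forest by a single
  vertex \<open>p\<close> pulls back to a set whose boundary is mapped into the ball around \<open>p\<close>, and thus has
  bounded size.\<close>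

lemma regular_into_locally_forest:
  assumes G: "sparse_expander d g0 G" "pverts G \<noteq> {}"
    and H: "pair_graph H" "locally_forest g H" "\<And>v. card {u. (v, u) \<in> parcs H} \<le> d"
    and maps: "\<phi> ` pverts G \<subseteq> pverts H"
    and lip: "\<And>x y. (x, y) \<in> parcs G \<Longrightarrow> \<phi> y \<in> relball (parcs H) K (\<phi> x)"
    and fibres: "\<And>z. z \<in> pverts H \<Longrightarrow> card {x \<in> pverts G. \<phi> x = z} \<le> N"
    and size: "card (pverts G) * (d + 1) ^ K \<le> g"
  shows "card (pverts G) < 2 * (N + (d + 1) * (2 * N * (d + 1) ^ K))"
proof (rule ccontr)
  assume "\<not> ?thesis"
  then have large: "2 * (N + (d + 1) * (2 * N * (d + 1) ^ K)) \<le> card (pverts G)" by simp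
  interpret G: pair_graph G using G(1) by (simp add: sparse_expander_def)
  interpret H: pair_graph H by fact
  define V where "V = pverts G"
  define E where "E = parcs H"
  \<comment> \<open>A ball of radius \<open>K\<close> has at most (d + 1)^K points, each with at
    most \<open>N\<close> preimages; \<open>t\<close> is twice this bound, the factor 2 matching the
    expansion constant 1/2.\<close>
  define t where "t = 2 * N * (d + 1) ^ K"
  \<comment> \<open>Whole balls are taken so that, for every arc (x, y) of \<open>G\<close>, a walk
    from \<phi> x to \<phi> y of length at most \<open>K\<close> lies in \<open>S\<close>. Where it
    exits from \<open>D\<close>, it uses an edge from \<open>D\<close> to
    \<open>S - D\<close>.\<close>
  define S where "S = (\<Union>x\<in>V. relball E K (\<phi> x))"
  define w where "w z = card {x \<in> V. \<phi> x = z}" for z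
  have finV: "finite V" by (simp add: V_def)
  have finE: "finite E" by (simp add: E_def)
  have ball: "finite (relball E K z)" "card (relball E K z) \<le> (d + 1) ^ K" for z
    using card_relball[OF finE, of d K z] H(3) by (auto simp: E_def)
  have centre: "z \<in> relball E K z" for z by (auto simp: relball_def intro!: exI[of _ 0])
  have finS: "finite S" using finV ball by (auto simp: S_def)
  have SV: "S \<subseteq> pverts H"
  proof
    fix z assume "z \<in> S"
    then obtain x j where "x \<in> V" "(\<phi> x, z) \<in> E ^^ j" by (auto simp: S_def relball_def)
    moreover have "\<phi> x \<in> pverts H" using maps \<open>x \<in> V\<close> by (auto simp: V_def)
    ultimately show "z \<in> pverts H"
      by (rule_tac relpow_closed) (auto simp: E_def dest: H.in_arcsD2)
  qed
  have "card S \<le> (\<Sum>x\<in>V. card (relball E K (\<phi> x)))" unfolding S_def by (rule card_UN_le[OF finV])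
  also have "\<dots> \<le> (\<Sum>x\<in>V. (d + 1) ^ K)" by (intro sum_mono ball)
  also have "\<dots> \<le> g" using size by (simp add: V_def)
  finally have cardS: "card S \<le> g" .
  have forest: "\<exists>v\<in>T. card {u \<in> T. (v, u) \<in> E} \<le> 1" if "T \<subseteq> S" "T \<noteq> {}" for T
  proof -
    have "card T \<le> g" using card_mono[OF finS that(1)] cardS by simp
    then show ?thesis using H(2) that SV unfolding locally_forest_def E_def by (meson order_trans)
  qed
  have symE: "sym E" by (auto simp: sym_def E_def H.arcs_symmetric)
  have degS: "card {u \<in> S. (v, u) \<in> E} \<le> d" for v
  proof -
    have "finite {u. (v, u) \<in> E}" by (rule finite_subset[OF _ finite_imageI[OF finE, of snd]]) force
    then have "card {u \<in> S. (v, u) \<in> E} \<le> card {u. (v, u) \<in> E}" by (intro card_mono) auto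
    then show ?thesis using H(3)[of v] by (simp add: E_def)
  qed
  obtain x0 where x0: "x0 \<in> V" using G(2) by (auto simp: V_def)
  then have "\<phi> x0 \<in> S" using centre by (auto simp: S_def)
  moreover have "0 < w (\<phi> x0)" using x0 finV by (auto simp: w_def card_gt_0_iff)
  moreover have "w z \<le> N" if "z \<in> S" for z using fibres[of z] that SV by (auto simp: w_def V_def)
  ultimately obtain D p where D: "D \<subseteq> S" "0 < sum w D" "sum w D \<le> N + (d + 1) * t"
    and exit: "\<And>u y. u \<in> D \<Longrightarrow> y \<in> S - D \<Longrightarrow> (u, y) \<in> E \<Longrightarrow> u = p \<and> t < sum w D"
    using forest_separator[OF finS forest symE degS, of w N "\<phi> x0" t] by metis
  define A where "A = {x \<in> V. \<phi> x \<in> D}"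
  have finD: "finite D" using D(1) finS finite_subset by blast
  have cardA: "card A = sum w D" unfolding A_def w_def using sum_card_fibres[OF finV finD] by simp
  have "A \<subseteq> pverts G" by (auto simp: A_def V_def)
  moreover have "A \<noteq> {}" using D(2) cardA by (metis card.empty less_irrefl)
  moreover have "2 * card A \<le> card (pverts G)"
    using mult_le_mono2[OF D(3), of 2] large unfolding t_def cardA by (rule order_trans)
  ultimately have exp: "card A \<le> 2 * card (vertex_boundary G A)"
    using G(1) by (auto simp: sparse_expander_def)
  have bd: "t < sum w D \<and> \<phi> y \<in> relball E K p" if y: "y \<in> vertex_boundary G A" for y
  proof -
    obtain x where x: "x \<in> A" "(x, y) \<in> parcs G" and "y \<in> V" "y \<notin> A"
      using y by (auto simp: vertex_boundary_def V_def)
    then have xV: "x \<in> V" and xD: "\<phi> x \<in> D" and yD: "\<phi> y \<notin> D" by (auto simp: A_def)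
    obtain j where j: "j \<le> K" "(\<phi> x, \<phi> y) \<in> E ^^ j"
      using lip[OF x(2)] by (auto simp: relball_def E_def)
    obtain i u z where *: "i < j" "(\<phi> x, z) \<in> E ^^ Suc i" "u \<in> D" "z \<notin> D" "(u, z) \<in> E" "(u, \<phi> y) \<in> E ^^ (j - i)"
      using relpow_exit[OF j(2) xD yD] by blast
    have "Suc i \<le> K" using *(1) j(1) by simp
    then have "z \<in> relball E K (\<phi> x)" using *(2) unfolding relball_def by blast
    then have "z \<in> S - D" using xV *(4) by (auto simp: S_def)
    then have "u = p \<and> t < sum w D" using exit *(3,5) by blast
    moreover have "j - i \<le> K" using j(1) by simp
    ultimately show ?thesis using *(6) unfolding relball_def by blast
  qed
  \<comment> \<open>Expansion forces the nonempty set \<open>A\<close> to have a boundary, so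
    \<open>D\<close> is left by some edge and therefore weighs more than \<open>t\<close>.\<close>
  have "card (vertex_boundary G A) > 0" using exp cardA D(2) by simp
  then obtain y where "y \<in> vertex_boundary G A" by (metis card.empty equals0I less_irrefl)
  then have "t < card A" using bd cardA by simp
  have "vertex_boundary G A \<subseteq> {y \<in> V. \<phi> y \<in> relball E K p \<inter> pverts H}"
    using bd maps by (auto simp: vertex_boundary_def V_def)
  then have "card (vertex_boundary G A) \<le> card {y \<in> V. \<phi> y \<in> relball E K p \<inter> pverts H}"
    using finV by (intro card_mono) auto
  also have "\<dots> = (\<Sum>z\<in>relball E K p \<inter> pverts H. w z)"
    unfolding w_def using sum_card_fibres[OF finV, of "relball E K p \<inter> pverts H" \<phi>] ball by simp
  also have "\<dots> \<le> (\<Sum>z\<in>relball E K p \<inter> pverts H. N)"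
    using fibres by (intro sum_mono) (auto simp: w_def V_def)
  also have "\<dots> \<le> card (relball E K p) * N" using ball by (simp add: card_mono)
  also have "\<dots> \<le> (d + 1) ^ K * N" using ball by (intro mult_le_mono1)
  finally have "2 * card (vertex_boundary G A) \<le> t" by (simp add: t_def mult_ac)
  then show False using exp \<open>t < card A\<close> by linarith
qed

section \<open>Regular maps between disjoint unions\<close>

text \<open>A closed set and its complement, which by symmetry is closed as well, have empty
  boundary. One of them has at most half of the vertices and, being nonempty, would have to
  expand.\<close>

lemma sparse_expander_connected:
  assumes "sparse_expander d g G" "A \<subseteq> pverts G" "A \<noteq> {}"
    and closed: "\<And>x y. x \<in> A \<Longrightarrow> (x, y) \<in> parcs G \<Longrightarrow> y \<in> A"
  shows "A = pverts G"
proof (rule ccontr)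
  assume neq: "A \<noteq> pverts G"
  interpret pair_graph G using assms(1) by (simp add: sparse_expander_def)
  have finA: "finite A" using assms(2) by (rule finite_subset) simp
  have exp: "card B \<le> 2 * card (vertex_boundary G B)"
    if "B \<subseteq> pverts G" "B \<noteq> {}" "2 * card B \<le> card (pverts G)" for B
    using assms(1) that by (simp add: sparse_expander_def)
  have "vertex_boundary G A = {}" using closed by (auto simp: vertex_boundary_def)
  moreover have "vertex_boundary G (pverts G - A) = {}"
    using closed by (auto simp: vertex_boundary_def dest: arcs_symmetric)
  moreover have "card A > 0" using finA assms(3) by (simp add: card_gt_0_iff)
  moreover have "card (pverts G - A) > 0" using neq assms(2) by (auto simp: card_gt_0_iff)
  moreover have "card (pverts G - A) = card (pverts G) - card A"
    by (rule card_Diff_subset[OF finA assms(2)])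
  ultimately show False using exp[of A] exp[of "pverts G - A"] assms(2,3) by fastforce
qed

lemma cheeger_constant_ge:
  assumes "sparse_expander d g G" "2 \<le> card (pverts G)"
  shows "1 / 2 \<le> cheeger_constant G"
proof -
  interpret pair_graph G using assms(1) by (simp add: sparse_expander_def)
  define Q where "Q = {A. A \<noteq> {} \<and> A \<subseteq> pverts G \<and> real (card A) \<le> real (card (pverts G)) / 2}"
  define f where "f A = real (card (vertex_boundary G A)) / real (card A)" for A
  have Q: "cheeger_constant G = Min (f ` Q)"
    unfolding cheeger_constant_def Q_def f_def by (rule arg_cong[of _ _ Min]) auto
  have "finite Q" by (rule finite_subset[of _ "Pow (pverts G)"]) (auto simp: Q_def)
  \<comment> \<open>\<open>Min\<close> of the empty set is unspecified; a singleton is admissible as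
    there are at least two vertices.\<close>
  moreover have "Q \<noteq> {}"
  proof -
    obtain x where "x \<in> pverts G" using assms(2) by fastforce
    then have "{x} \<in> Q" using assms(2) by (simp add: Q_def)
    then show ?thesis by blast
  qed
  moreover have "1 / 2 \<le> f A" if "A \<in> Q" for A
  proof -
    have A: "A \<subseteq> pverts G" "A \<noteq> {}" "2 * card A \<le> card (pverts G)" using that by (auto simp: Q_def)
    have "finite A" using A(1) by (rule finite_subset) simp
    then have "0 < card A" using A(2) by (simp add: card_gt_0_iff)
    moreover have "card A \<le> 2 * card (vertex_boundary G A)"
      using assms(1) A by (simp add: sparse_expander_def)
    ultimately show ?thesis by (simp add: f_def field_simps flip: of_nat_mult)
  qed
  ultimately show ?thesis unfolding Q by (subst Min_ge_iff) auto
qed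

lemma not_digraph_iso_if_card_neq:
  assumes "card (pverts G) \<noteq> card (pverts H)"
  shows "\<not> digraph_iso (with_proj G) (with_proj H)"
proof
  assume "digraph_iso (with_proj G) (with_proj H)"
  then obtain f where f: "pre_digraph.digraph_isomorphism (with_proj G) f" "with_proj H = app_iso f (with_proj G)"
    by (auto simp: digraph_iso_def)
  then have "pverts H = iso_verts f ` pverts G" by (metis verts_app_iso with_proj_simps(1))
  moreover have "inj_on (iso_verts f) (pverts G)"
    using f(1) by (simp add: pre_digraph.digraph_isomorphism_def)
  ultimately show False using assms by (simp add: card_image)
qed

lemma graph_dist_arc:
  assumes "pair_wf_digraph G" "(x, y) \<in> parcs G"
  shows "graph_dist G x y \<le> 1" "0 \<le> graph_dist G x y"
proof -
  interpret pair_wf_digraph G by fact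
  have "awalk x [(x, y)] y" using assms(2) by (auto simp: awalk_def dest: in_arcsD1)
  then have "\<mu> (\<lambda>_. 1) x y \<le> awalk_cost (\<lambda>_. 1) [(x, y)]" by (rule min_cost_le_walk_cost)
  then show "graph_dist G x y \<le> 1" by (simp add: graph_dist_def one_ereal_def)
  show "0 \<le> graph_dist G x y"
    unfolding graph_dist_def \<mu>_def by (rule INF_greatest) (auto intro: pos_cost_pos_awalk_cost)
qed

text \<open>The distance is an infimum over walks, so some walk costs less than k + 1. Costs being
  integers, its length is at most k, and no shortest walk has to be produced.\<close>

lemma relball_if_graph_dist_le:
  assumes "pair_wf_digraph G" "graph_dist G x y \<le> ereal (real k)"
  shows "y \<in> relball (parcs G) k x"
proof -
  interpret pair_wf_digraph G by fact
  have "\<mu> (\<lambda>_. 1) x y < ereal (real k + 1)"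
    using assms(2) by (simp add: graph_dist_def) (meson ereal_less_eq(3) le_less_trans less_ereal.simps(1) less_add_one)
  then obtain p where p: "awalk x p y" "awalk_cost (\<lambda>_. 1) p < real k + 1"
    unfolding \<mu>_def by (auto simp: INF_less_iff)
  have "awalk_cost (\<lambda>_. 1) p = real (length p)" by (induction p) auto
  then have "length p \<le> k" using p(2) by simp
  moreover have "(x, y) \<in> parcs G ^^ length p" using p(1)
  proof (induction p arbitrary: x)
    case (Cons e p)
    then have "(x, snd e) \<in> parcs G" "(snd e, y) \<in> parcs G ^^ length p"
      by (auto simp: awalk_Cons_iff)
    then show ?case by (metis length_Cons relpow_Suc_I2)
  qed (simp add: awalk_Nil_iff)
  ultimately show ?thesis unfolding relball_def by blast
qed

lemma regular_graph_map_arcs: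
  assumes "regular_graph_map X Y \<phi>" "pair_wf_digraph X" "pair_wf_digraph Y"
  obtains K where "\<And>x y. (x, y) \<in> parcs X \<Longrightarrow> \<phi> y \<in> relball (parcs Y) K (\<phi> x)"
proof -
  interpret X: pair_wf_digraph X by fact
  obtain K :: real where K: "\<And>x y. x \<in> pverts X \<Longrightarrow> y \<in> pverts X \<Longrightarrow> reachable (with_proj X) x y \<Longrightarrow>
      graph_dist Y (\<phi> x) (\<phi> y) \<le> ereal K * graph_dist X x y"
    using assms(1) unfolding regular_graph_map_def by blast
  show ?thesis
  \<comment> \<open>The Lipschitz constant may be fractional or negative; rounding it up to a
    natural number is harmless as distances are nonnegative.\<close>
  proof (rule that[of "nat \<lceil>K\<rceil>"])
    fix x y assume xy: "(x, y) \<in> parcs X"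
    have "reachable (with_proj X) x y" using xy by (simp add: X.adj_in_verts X.reachable_adjI)
    then have "graph_dist Y (\<phi> x) (\<phi> y) \<le> ereal K * graph_dist X x y"
      using K X.in_arcsD1[OF xy] X.in_arcsD2[OF xy] by blast
    also have "\<dots> \<le> ereal (real (nat \<lceil>K\<rceil>)) * graph_dist X x y"
      using graph_dist_arc(2)[OF assms(2) xy] by (intro ereal_mult_right_mono) (auto simp: real_nat_ceiling_ge)
    also have "\<dots> \<le> ereal (real (nat \<lceil>K\<rceil>)) * 1"
      using graph_dist_arc(1)[OF assms(2) xy] by (intro ereal_mult_left_mono) auto
    finally have "graph_dist Y (\<phi> x) (\<phi> y) \<le> ereal (real (nat \<lceil>K\<rceil>))" by simp
    then show "\<phi> y \<in> relball (parcs Y) (nat \<lceil>K\<rceil>) (\<phi> x)" by (rule relball_if_graph_dist_le[OF assms(3)])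
  qed
qed

definition graph_union :: "('i \<Rightarrow> 'a pair_pre_digraph) \<Rightarrow> 'a pair_pre_digraph" where
  "graph_union \<Gamma> = \<lparr>pverts = (\<Union>i. pverts (\<Gamma> i)), parcs = (\<Union>i. parcs (\<Gamma> i))\<rparr>"

lemma graph_union_arcD:
  assumes "\<And>i. pair_graph (\<Gamma> i)" "disjoint_family (\<lambda>i. pverts (\<Gamma> i))"
    and "(x, y) \<in> parcs (graph_union \<Gamma>)" "x \<in> pverts (\<Gamma> i)"
  shows "(x, y) \<in> parcs (\<Gamma> i)"
proof -
  obtain j where j: "(x, y) \<in> parcs (\<Gamma> j)" using assms(3) by (auto simp: graph_union_def)
  interpret pair_graph "\<Gamma> j" by fact
  have "x \<in> pverts (\<Gamma> j)" using j by (rule in_arcsD1)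
  then have "i = j" using assms(2,4) by (auto simp: disjoint_family_on_def)
  with j show ?thesis by simp
qed

lemma graph_union_relballD:
  assumes "\<And>i. pair_graph (\<Gamma> i)" "disjoint_family (\<lambda>i. pverts (\<Gamma> i))"
    and "y \<in> relball (parcs (graph_union \<Gamma>)) k x" "x \<in> pverts (\<Gamma> i)"
  shows "y \<in> pverts (\<Gamma> i) \<and> y \<in> relball (parcs (\<Gamma> i)) k x"
proof -
  interpret pair_graph "\<Gamma> i" by fact
  obtain j where j: "j \<le> k" "(x, y) \<in> parcs (graph_union \<Gamma>) ^^ j" using assms(3) by (auto simp: relball_def)
  from j(2) have "y \<in> pverts (\<Gamma> i) \<and> (x, y) \<in> parcs (\<Gamma> i) ^^ j"
  proof (induction j arbitrary: y)
    case (Suc j)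
    then obtain z where z: "(x, z) \<in> parcs (graph_union \<Gamma>) ^^ j" "(z, y) \<in> parcs (graph_union \<Gamma>)" by auto
    then have "z \<in> pverts (\<Gamma> i)" "(x, z) \<in> parcs (\<Gamma> i) ^^ j" using Suc.IH by auto
    moreover from this have "(z, y) \<in> parcs (\<Gamma> i)" using graph_union_arcD[OF assms(1,2) z(2)] by blast
    ultimately show ?case by (auto dest: in_arcsD2)
  qed (use assms(4) in simp)
  then show ?thesis using j(1) unfolding relball_def by blast
qed

lemma pair_wf_digraph_graph_union:
  assumes "\<And>i. pair_graph (\<Gamma> i)"
  shows "pair_wf_digraph (graph_union \<Gamma>)"
proof -
  have "x \<in> pverts (\<Gamma> i) \<and> y \<in> pverts (\<Gamma> i)" if "(x, y) \<in> parcs (\<Gamma> i)" for x y i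
  proof -
    interpret pair_graph "\<Gamma> i" by fact
    show ?thesis using that by (blast dest: in_arcsD1 in_arcsD2)
  qed
  then show ?thesis by unfold_locales (fastforce simp: graph_union_def)+
qed

text \<open>Components are non-isomorphic because their sizes differ, and degrees in the union are
  degrees in a component because no arcs run between components.\<close>

lemma bounded_degree_expander_graph_union:
  fixes \<Gamma> :: "nat \<Rightarrow> 'a pair_pre_digraph"
  assumes \<Gamma>: "\<And>i. sparse_expander d (g i) (\<Gamma> i)" "\<And>i. 2 \<le> card (pverts (\<Gamma> i))"
    and disj: "disjoint_family (\<lambda>i. pverts (\<Gamma> i))" and inj: "inj (\<lambda>i. card (pverts (\<Gamma> i)))"
  shows "bounded_degree_expander d (1 / 2) (graph_union \<Gamma>)"
proof -
  have graph: "pair_graph (\<Gamma> i)" for i using \<Gamma>(1) by (simp add: sparse_expander_def)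
  have "\<not> digraph_iso (with_proj (\<Gamma> i)) (with_proj (\<Gamma> j))" if "i \<noteq> j" for i j
    using inj that by (intro not_digraph_iso_if_card_neq) (auto dest: injD)
  moreover have "is_disjoint_union (graph_union \<Gamma>) \<Gamma>"
    using disj by (simp add: is_disjoint_union_def graph_union_def)
  ultimately have "expander (1 / 2) (graph_union \<Gamma>)"
    unfolding expander_def using graph \<Gamma>(2) cheeger_constant_ge[OF \<Gamma>] by (intro conjI exI[of _ \<Gamma>]) auto
  moreover have "out_degree (with_proj (graph_union \<Gamma>)) v \<le> d" if v: "v \<in> pverts (graph_union \<Gamma>)" for v
  proof -
    obtain i where i: "v \<in> pverts (\<Gamma> i)" using v by (auto simp: graph_union_def)
    interpret pair_graph "\<Gamma> i" by (rule graph)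
    have "out_arcs (with_proj (graph_union \<Gamma>)) v \<subseteq> Pair v ` {u. (v, u) \<in> parcs (\<Gamma> i)}"
      using graph_union_arcD[OF graph disj _ i] by (auto simp: out_arcs_def)
    moreover have "finite {u. (v, u) \<in> parcs (\<Gamma> i)}"
      by (rule finite_subset[of _ "pverts (\<Gamma> i)"]) (auto dest: in_arcsD2)
    ultimately have "out_degree (with_proj (graph_union \<Gamma>)) v \<le> card {u. (v, u) \<in> parcs (\<Gamma> i)}"
      unfolding out_degree_def by (metis surj_card_le)
    also have "\<dots> \<le> d" using \<Gamma>(1)[of i] by (simp add: sparse_expander_def)
    finally show ?thesis .
  qed
  ultimately show ?thesis by (simp add: bounded_degree_expander_def)
qed

text \<open>The vertices of a component that \<phi> sends into one given component of the target
  form a set closed under adjacency, since images of adjacent vertices are joined by a walk.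
  Connectedness makes it the whole component. \<open>K\<close> and \<open>N\<close> do not depend on
  \<open>i\<close>.\<close>

lemma regular_graph_map_component:
  assumes reg: "regular_graph_map (graph_union \<Gamma>) (graph_union \<Delta>) \<phi>"
    and \<Gamma>: "\<And>i. sparse_expander d (g i) (\<Gamma> i)" "\<And>i. pverts (\<Gamma> i) \<noteq> {}"
    and \<Delta>: "\<And>j. pair_graph (\<Delta> j)" "disjoint_family (\<lambda>j. pverts (\<Delta> j))"
  obtains K N where "\<And>i. \<exists>j. \<phi> ` pverts (\<Gamma> i) \<subseteq> pverts (\<Delta> j) \<and>
      (\<forall>x y. (x, y) \<in> parcs (\<Gamma> i) \<longrightarrow> \<phi> y \<in> relball (parcs (\<Delta> j)) K (\<phi> x)) \<and>
      (\<forall>z\<in>pverts (\<Delta> j). card {x \<in> pverts (\<Gamma> i). \<phi> x = z} \<le> N)"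
proof -
  have graph: "pair_graph (\<Gamma> i)" for i using \<Gamma>(1) by (simp add: sparse_expander_def)
  obtain K where K: "\<And>x y. (x, y) \<in> parcs (graph_union \<Gamma>) \<Longrightarrow> \<phi> y \<in> relball (parcs (graph_union \<Delta>)) K (\<phi> x)"
    using regular_graph_map_arcs[OF reg pair_wf_digraph_graph_union[OF graph] pair_wf_digraph_graph_union[OF \<Delta>(1)]]
    by metis
  obtain N where N: "\<And>z. z \<in> pverts (graph_union \<Delta>) \<Longrightarrow>
      finite {x \<in> pverts (graph_union \<Gamma>). \<phi> x = z} \<and> card {x \<in> pverts (graph_union \<Gamma>). \<phi> x = z} \<le> N"
    using reg unfolding regular_graph_map_def by blast
  show ?thesis
  proof (rule that[of K N])
    fix i
    interpret pair_graph "\<Gamma> i" by (rule graph)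
    obtain x0 where x0: "x0 \<in> pverts (\<Gamma> i)" using \<Gamma>(2) by blast
    have "x0 \<in> pverts (graph_union \<Gamma>)" using x0 by (auto simp: graph_union_def)
    moreover have "\<phi> ` pverts (graph_union \<Gamma>) \<subseteq> pverts (graph_union \<Delta>)"
      using reg by (simp add: regular_graph_map_def)
    ultimately have "\<phi> x0 \<in> pverts (graph_union \<Delta>)" by blast
    then obtain j where j: "\<phi> x0 \<in> pverts (\<Delta> j)" by (auto simp: graph_union_def)
    have step: "\<phi> y \<in> pverts (\<Delta> j) \<and> \<phi> y \<in> relball (parcs (\<Delta> j)) K (\<phi> x)"
      if "\<phi> x \<in> pverts (\<Delta> j)" "(x, y) \<in> parcs (\<Gamma> i)" for x y
    proof (rule graph_union_relballD[OF \<Delta> K that(1)])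
      show "(x, y) \<in> parcs (graph_union \<Gamma>)" using that(2) by (auto simp: graph_union_def)
    qed
    have "{x \<in> pverts (\<Gamma> i). \<phi> x \<in> pverts (\<Delta> j)} = pverts (\<Gamma> i)"
      using x0 j step by (intro sparse_expander_connected[OF \<Gamma>(1)]) (auto dest: in_arcsD2)
    then have maps: "\<phi> ` pverts (\<Gamma> i) \<subseteq> pverts (\<Delta> j)" by blast
    have "card {x \<in> pverts (\<Gamma> i). \<phi> x = z} \<le> N" if "z \<in> pverts (\<Delta> j)" for z
    proof -
      have z: "z \<in> pverts (graph_union \<Delta>)" using that by (auto simp: graph_union_def)
      have "card {x \<in> pverts (\<Gamma> i). \<phi> x = z} \<le> card {x \<in> pverts (graph_union \<Gamma>). \<phi> x = z}"
        using N[OF z] by (intro card_mono) (auto simp: graph_union_def)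
      then show ?thesis using N[OF z] by simp
    qed
    moreover have "\<phi> y \<in> relball (parcs (\<Delta> j)) K (\<phi> x)" if "(x, y) \<in> parcs (\<Gamma> i)" for x y
      using step[OF _ that] maps in_arcsD1[OF that] by blast
    ultimately show "\<exists>j. \<phi> ` pverts (\<Gamma> i) \<subseteq> pverts (\<Delta> j) \<and>
      (\<forall>x y. (x, y) \<in> parcs (\<Gamma> i) \<longrightarrow> \<phi> y \<in> relball (parcs (\<Delta> j)) K (\<phi> x)) \<and>
      (\<forall>z\<in>pverts (\<Delta> j). card {x \<in> pverts (\<Gamma> i). \<phi> x = z} \<le> N)" using maps by blast
  qed
qed

section \<open>Rapidly growing sequences of sparse expanders\<close>

text \<open>Graphs are first chosen for all pairs of an index and a scale, with vertices among the
  codes of pairs (i, v) for index \<open>i\<close>, which makes them disjoint. The scales are then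
  defined by recursion on the sizes obtained. The summand 2 keeps every graph at two vertices or
  more.\<close>

lemma exists_sparse_expander_sequence:
  obtains d g and \<Gamma> :: "nat \<Rightarrow> nat pair_pre_digraph"
  where "\<And>i. sparse_expander d (g i) (\<Gamma> i)" "disjoint_family (\<lambda>i. pverts (\<Gamma> i))"
    "g 0 = 2" "\<And>i. g (Suc i) = (card (pverts (\<Gamma> i)))\<^sup>2 + 2"
proof -
  obtain d where d: "\<forall>g. \<exists>n. \<forall>U :: nat set. finite U \<and> card U = n \<longrightarrow> (\<exists>G. pverts G \<subseteq> U \<and> sparse_expander d g G)"
    using exists_sparse_expander by blast
  have "\<exists>G. pverts G \<subseteq> range (\<lambda>v. prod_encode (i, v)) \<and> sparse_expander d g G" for i g
  proof -
    obtain n where n: "\<And>U :: nat set. finite U \<Longrightarrow> card U = n \<Longrightarrow> \<exists>G. pverts G \<subseteq> U \<and> sparse_expander d g G"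
      using d by metis
    have "inj (\<lambda>v. prod_encode (i, v))" by (auto intro!: injI dest: injD[OF inj_prod_encode])
    then have "card ((\<lambda>v. prod_encode (i, v)) ` {..<n}) = n"
      by (subst card_image) (auto intro: inj_on_subset)
    then obtain G where "pverts G \<subseteq> (\<lambda>v. prod_encode (i, v)) ` {..<n}" "sparse_expander d g G"
      using n[of "(\<lambda>v. prod_encode (i, v)) ` {..<n}"] by auto
    then show ?thesis by blast
  qed
  then obtain F where F: "\<And>i g. pverts (F i g) \<subseteq> range (\<lambda>v. prod_encode (i, v))" "\<And>i g. sparse_expander d g (F i g)"
    by metis
  define g where "g = rec_nat 2 (\<lambda>i g. (card (pverts (F i g)))\<^sup>2 + 2)"
  have "disjoint_family (\<lambda>i. pverts (F i (g i)))"
    unfolding disjoint_family_on_def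
  proof (intro ballI impI)
    fix i j :: nat assume "i \<noteq> j"
    then have "range (\<lambda>v. prod_encode (i, v)) \<inter> range (\<lambda>v. prod_encode (j, v)) = {}"
      by (auto dest: injD[OF inj_prod_encode])
    then show "pverts (F i (g i)) \<inter> pverts (F j (g j)) = {}"
      using Int_mono[OF F(1)[of i "g i"] F(1)[of j "g j"]] by (metis subset_empty)
  qed
  then show ?thesis by (intro that[of d g "\<lambda>i. F i (g i)"] F(2)) (simp_all add: g_def)
qed

context
  fixes d :: nat and g :: "nat \<Rightarrow> nat" and \<Gamma> :: "nat \<Rightarrow> nat pair_pre_digraph"
  assumes \<Gamma>: "\<And>i. sparse_expander d (g i) (\<Gamma> i)" and disj: "disjoint_family (\<lambda>i. pverts (\<Gamma> i))"
    and g: "g 0 = 2" "\<And>i. g (Suc i) = (card (pverts (\<Gamma> i)))\<^sup>2 + 2"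
begin

lemma g_le_card: "g i \<le> card (pverts (\<Gamma> i))"
  using \<Gamma>[of i] by (simp add: sparse_expander_def)

lemma two_le_card: "2 \<le> card (pverts (\<Gamma> i))"
  using g_le_card[of i] g by (cases i) auto

lemma strict_mono_card: "strict_mono (\<lambda>i. card (pverts (\<Gamma> i)))"
proof (rule strict_mono_Suc_iff[THEN iffD2], rule allI)
  fix i
  have "card (pverts (\<Gamma> i)) < (card (pverts (\<Gamma> i)))\<^sup>2 + 2"
    using self_le_power[of "card (pverts (\<Gamma> i))" 2] two_le_card[of i] by linarith
  then show "card (pverts (\<Gamma> i)) < card (pverts (\<Gamma> (Suc i)))"
    using g_le_card[of "Suc i"] g(2)[of i] by linarith
qed

lemma le_card: "i \<le> card (pverts (\<Gamma> i))"
  using strict_mono_imp_increasing[OF strict_mono_card] .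

lemma card_square_le_g:
  assumes "i < j"
  shows "(card (pverts (\<Gamma> i)))\<^sup>2 + 2 \<le> g j"
proof -
  obtain l where l: "j = Suc l" "i \<le> l" using assms by (cases j) auto
  have "card (pverts (\<Gamma> i)) \<le> card (pverts (\<Gamma> l))"
    using strict_mono_mono[OF strict_mono_card] l(2) by (simp add: mono_def)
  then show ?thesis using l(1) g(2) by (simp add: power_mono)
qed

lemma disjoint_family_subsequence:
  "inj e \<Longrightarrow> disjoint_family (\<lambda>n. pverts (\<Gamma> (e n)))"
  using disj by (auto simp: disjoint_family_on_def dest: injD)

lemma bounded_degree_expander_subsequence:
  fixes e :: "nat \<Rightarrow> nat"
  assumes "inj e"
  shows "bounded_degree_expander d (1 / 2) (graph_union (\<lambda>n. \<Gamma> (e n)))"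
proof (rule bounded_degree_expander_graph_union[where g = "\<lambda>n. g (e n)"])
  show "inj (\<lambda>n. card (pverts (\<Gamma> (e n))))"
    using inj_compose[OF strict_mono_imp_inj_on[OF strict_mono_card] assms] by (simp add: o_def)
qed (rule \<Gamma> two_le_card disjoint_family_subsequence[OF assms])+

text \<open>A single component of the source, with an index \<open>i\<close> that the target lacks,
  gives the contradiction. The difference is infinite so that \<open>i\<close> can exceed a bound
  made from the constants of \<phi>.\<close>

lemma no_regular_graph_map_subsequence:
  fixes e e' :: "nat \<Rightarrow> nat"
  assumes inf: "infinite (range e - range e')" and "inj e'"
  shows "\<not> regular_graph_map (graph_union (\<lambda>n. \<Gamma> (e n))) (graph_union (\<lambda>n. \<Gamma> (e' n))) \<phi>"
proof
  assume reg: "regular_graph_map (graph_union (\<lambda>n. \<Gamma> (e n))) (graph_union (\<lambda>n. \<Gamma> (e' n))) \<phi>"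
  have graph: "pair_graph (\<Gamma> i)" for i using \<Gamma>[of i] by (simp add: sparse_expander_def)
  have fin: "finite (pverts (\<Gamma> i))" for i using two_le_card[of i] by (intro card_ge_0_finite) simp
  have ne: "pverts (\<Gamma> i) \<noteq> {}" for i using two_le_card[of i] by auto
  obtain K N where KN: "\<And>n. \<exists>m. \<phi> ` pverts (\<Gamma> (e n)) \<subseteq> pverts (\<Gamma> (e' m)) \<and>
      (\<forall>x y. (x, y) \<in> parcs (\<Gamma> (e n)) \<longrightarrow> \<phi> y \<in> relball (parcs (\<Gamma> (e' m))) K (\<phi> x)) \<and>
      (\<forall>z\<in>pverts (\<Gamma> (e' m)). card {x \<in> pverts (\<Gamma> (e n)). \<phi> x = z} \<le> N)"
    by (rule regular_graph_map_component[OF reg \<Gamma> ne graph disjoint_family_subsequence[OF \<open>inj e'\<close>]]) blast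
  \<comment> \<open>The summands serve, in turn, to bound the fibres if j < i, to bound the balls if
    j > i, and to contradict the size bound for \<Gamma> i in that second case.\<close>
  define B where "B = N + (d + 1) ^ K + 2 * (N + (d + 1) * (2 * N * (d + 1) ^ K))"
  obtain i where i: "B < i" "i \<in> range e - range e'"
    using inf unfolding infinite_nat_iff_unbounded by blast
  then obtain n where n: "i = e n" by blast
  obtain m where maps: "\<phi> ` pverts (\<Gamma> i) \<subseteq> pverts (\<Gamma> (e' m))"
    and lip: "\<And>x y. (x, y) \<in> parcs (\<Gamma> i) \<Longrightarrow> \<phi> y \<in> relball (parcs (\<Gamma> (e' m))) K (\<phi> x)"
    and fibres: "\<And>z. z \<in> pverts (\<Gamma> (e' m)) \<Longrightarrow> card {x \<in> pverts (\<Gamma> i). \<phi> x = z} \<le> N"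
    using KN[of n] unfolding n by blast
  define j where "j = e' m"
  have "j \<noteq> i" using i(2) unfolding j_def by blast
  then consider "j < i" | "i < j" by linarith
  then show False
  proof cases
    case 1
    \<comment> \<open>The map would give |\<Gamma> i| \<le> N |\<Gamma> j| \<le> |\<Gamma> l|^2 < g
      i, since N \<le> B \<le> l \<le> |\<Gamma> l|.\<close>
    then obtain l where l: "i = Suc l" "j \<le> l" by (cases i) auto
    have "{x \<in> pverts (\<Gamma> i). \<phi> x \<in> pverts (\<Gamma> j)} = pverts (\<Gamma> i)"
      using maps by (auto simp: j_def)
    then have "card (pverts (\<Gamma> i)) = (\<Sum>z\<in>pverts (\<Gamma> j). card {x \<in> pverts (\<Gamma> i). \<phi> x = z})"
      using sum_card_fibres[OF fin[of i] fin[of j], of \<phi>] by simp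
    also have "\<dots> \<le> (\<Sum>z\<in>pverts (\<Gamma> j). N)" using fibres by (intro sum_mono) (simp add: j_def)
    also have "\<dots> = card (pverts (\<Gamma> j)) * N" by simp
    also have "\<dots> \<le> card (pverts (\<Gamma> l)) * card (pverts (\<Gamma> l))"
    proof (rule mult_le_mono)
      show "card (pverts (\<Gamma> j)) \<le> card (pverts (\<Gamma> l))"
        using strict_mono_mono[OF strict_mono_card] l(2) by (simp add: mono_def)
      show "N \<le> card (pverts (\<Gamma> l))" using le_card[of l] i(1) l(1) by (simp add: B_def)
    qed
    also have "\<dots> < g i" using g(2)[of l] by (simp add: l(1) power2_eq_square)
    finally show False using g_le_card[of i] by simp
  next
    case 2
    \<comment> \<open>As |\<Gamma> i| \<ge> (d + 1)^K, the neighbourhood of the image has at most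
      |\<Gamma> i|^2 points, which is within the forest scale \<open>g j\<close>.\<close>
    have "card (pverts (\<Gamma> i)) * (d + 1) ^ K \<le> card (pverts (\<Gamma> i)) * card (pverts (\<Gamma> i))"
      using le_card[of i] i(1) by (intro mult_le_mono2) (simp add: B_def)
    then have size: "card (pverts (\<Gamma> i)) * (d + 1) ^ K \<le> g j"
      using card_square_le_g[OF 2] unfolding power2_eq_square by linarith
    have "card (pverts (\<Gamma> i)) < 2 * (N + (d + 1) * (2 * N * (d + 1) ^ K))"
    proof (rule regular_into_locally_forest[OF \<Gamma> ne graph _ _
            maps[folded j_def] lip[folded j_def] fibres[folded j_def] size])
      show "locally_forest (g j) (\<Gamma> j)" "\<And>v. card {u. (v, u) \<in> parcs (\<Gamma> j)} \<le> d"
        using \<Gamma>[of j] by (simp_all add: sparse_expander_def)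
    qed
    then show False using le_card[of i] i(1) unfolding B_def by linarith
  qed
qed

end

section \<open>Almost disjoint index sets for the real numbers\<close>

text \<open>The range codes the graph of the function that takes n to the floor of r n. Keeping n as
  first coordinate gives injectivity and forces common elements of two ranges to come from the same
  n.\<close>

definition real_code :: "real \<Rightarrow> nat \<Rightarrow> nat" where
  "real_code r n = to_nat (n, \<lfloor>r * real n\<rfloor>)"

lemma inj_real_code: "inj (real_code r)"
  by (rule injI) (simp add: real_code_def)

text \<open>If r n and s n have equal floors, then n |r - s| < 1, which fails for all large n. So
  from some n on, the codes for r avoid the range for s.\<close>

lemma infinite_real_code_diff:
  assumes "r \<noteq> s"
  shows "infinite (range (real_code r) - range (real_code s))"
proof -
  obtain n0 where n0: "1 < real n0 * \<bar>r - s\<bar>"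
    using assms ex_less_of_nat_mult[of "\<bar>r - s\<bar>" 1] by auto
  have "real_code r ` {n0..} \<subseteq> range (real_code r) - range (real_code s)"
  proof (rule image_subsetI, rule DiffI, rule rangeI, rule notI)
    fix n assume "n \<in> {n0..}" "real_code r n \<in> range (real_code s)"
    then obtain m where "n0 \<le> n" "real_code r n = real_code s m" by auto
    then have "\<lfloor>r * real n\<rfloor> = \<lfloor>s * real n\<rfloor>" by (auto simp: real_code_def)
    then have "\<bar>r * real n - s * real n\<bar> < 1" by linarith
    moreover have "r * real n - s * real n = real n * (r - s)" by (simp add: algebra_simps)
    ultimately have "real n * \<bar>r - s\<bar> < 1" by (simp add: abs_mult)
    moreover have "real n0 * \<bar>r - s\<bar> \<le> real n * \<bar>r - s\<bar>"
      using \<open>n0 \<le> n\<close> by (intro mult_right_mono) auto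
    ultimately show False using n0 by linarith
  qed
  moreover have "infinite (real_code r ` {n0..})"
    using inj_real_code by (subst finite_image_iff) (auto intro: inj_on_subset simp: infinite_Ici)
  ultimately show ?thesis using finite_subset by blast
qed

theorem theorem1p1:
  shows "\<exists>(d::nat) (\<epsilon>::real) (X :: real \<Rightarrow> nat pair_pre_digraph).
           \<epsilon> > 0 \<and>
           (\<forall>r. bounded_degree_expander d \<epsilon> (X r)) \<and>
           (\<forall>r s. r \<noteq> s \<longrightarrow> \<not> (\<exists>\<phi>. regular_graph_map (X r) (X s) \<phi>))"
proof -
  obtain d g and \<Gamma> :: "nat \<Rightarrow> nat pair_pre_digraph"
    where \<Gamma>: "\<And>i. sparse_expander d (g i) (\<Gamma> i)" "disjoint_family (\<lambda>i. pverts (\<Gamma> i))"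
      "g 0 = 2" "\<And>i. g (Suc i) = (card (pverts (\<Gamma> i)))\<^sup>2 + 2"
    by (rule exists_sparse_expander_sequence) blast
  define X where "X r = graph_union (\<lambda>n. \<Gamma> (real_code r n))" for r
  have "bounded_degree_expander d (1 / 2) (X r)" for r
    unfolding X_def by (rule bounded_degree_expander_subsequence[OF \<Gamma> inj_real_code])
  moreover have "\<not> regular_graph_map (X r) (X s) \<phi>" if "r \<noteq> s" for r s \<phi>
    unfolding X_def
    by (rule no_regular_graph_map_subsequence[OF \<Gamma> infinite_real_code_diff[OF that] inj_real_code])
  ultimately have *: "(1 / 2 :: real) > 0 \<and> (\<forall>r. bounded_degree_expander d (1 / 2) (X r)) \<and>
      (\<forall>r s. r \<noteq> s \<longrightarrow> \<not> (\<exists>\<phi>. regular_graph_map (X r) (X s) \<phi>))"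
    by simp
  show ?thesis
    by (rule exI[of _ d], rule exI[of _ "1 / 2"], rule exI[of _ X], rule *)
qed

end
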